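(* Let $n\ge 1$, $t_1,\dots,t_n>0$ and $\alpha_1,\dots,\alpha_n\in(0,1)$, and consider the search game $G$ and the iterative algorithm described in the context. For arbitrary $\epsilon>0$ the algorithm terminates; that is, for every admissible choice of the LP optimal solutions $(\mathbf p_k,v_k)$ and of the Gittins search sequences $\xi_k\in\mathcal C^{\rm B}_{\mathbf p_k}$ made in the course of the algorithm, there is an iteration $k$ in which both stopping conditions hold: (i) $U_k/L_k-1<\epsilon$, and (ii) $p_{k,i}>\delta_i$ for all $i=1,\dots,n$ (where $\mathbf p_k=(p_{k,1},\dots,p_{k,n})$).
   Context: **Search game $G$.** A hider hides in one of $n$ boxes; a searcher searches boxes one at a time. A search of box $i$ takes time $t_i>0$ and finds the hider, if hidden there, with probability $\alpha_i\in(0,1)$, independently of all other searches. A pure search strategy (search sequence) is an element $\xi$ of $\mathcal C=\{1,\dots,n\}^{\infty}$, the ordered infinite list of boxes to search. A mixed hiding strategy is $\mathbf p=(p_1,\dots,p_n)$ in the probability simplex $\Delta^n$. For a box $i$ and $\xi\in\mathcal C$, $u(i,\xi)\in(0,\infty]$ is the expected total search time until detection (including the detecting search) when the hider is in box $i$ and the searcher follows $\xi$: $u(i,\xi)=\sum_{r\ge1}\alpha_i(1-\alpha_i)^{r-1}\tau_i(r,\xi)$, with $\tau_i(r,\xi)$ the time at which the $r$th search of box $i$ is completed under $\xi$, and $u(i,\xi)=\infty$ if box $i$ is searched only finitely often. Put $u(\mathbf p,\xi)=\sum_i p_iu(i,\xi)$ (with $0\cdot\infty=0$) and $u(\mathbf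 p)=\min_{\xi\in\mathcal C}u(\mathbf p,\xi)$. The hider maximizes and the searcher minimizes the expected time to detection. **Gittins search sequences.** $\xi\in\mathcal C$ is a Gittins search sequence against $\mathbf p$ if at every stage, when $m_i$ searches of box $i$ have already been made ($i=1,\dots,n$), the next box searched is some $j$ attaining $\max_i p_i(1-\alpha_i)^{m_i}\alpha_i/t_i$. The set of these is $\mathcal C^{\rm B}_{\mathbf p}$; it is known that these are exactly the minimizers of $u(\mathbf p,\cdot)$. The Gittins search sequence that breaks ties by a given preference ordering (a permutation of the boxes) always chooses, among the boxes attaining the maximum, the one coming first in that ordering. **Constants.** $M=\sum_{i=1}^n t_i/\alpha_i$, $m_i=\lfloor M/t_i\rfloor+1$, $c_i=\sum_{j\ne i}\frac{t_j}{\alpha_j(1-\alpha_j)^{m_j-1}}$, $\eta_i=\frac{t_i/\alpha_i}{t_i/\alpha_i+c_i}$. Fix constants $0<\delta_i<\eta_i$, $i=1,\dots,n$, and let $\Delta^n_+=\{\mathbf p:\sum_i p_i=1,\ p_i\ge\delta_i \text{ for all } i\}$. **Algorithm** (with tolerance $\epsilon>0$). 1. Let $\mathbf p_0=(p_{0,1},\dots,p_{0,n})$ with $p_{0,i}=\frac{t_i/\alpha_i}{\sum_j t_j/\alpha_j}$. Let $\mathcal D_1$ be the set of the $n$ Gittins search sequences against $\mathbf p_0$ that break all ties by the preference orderings $(1,2,\dots,n)$, $(2,3,\dots,n,1)$, ..., $(n,1,\dots,n-1)$, respectively. Set $k=1$. 2. In iteration $k$, let $(\mathbf p_k,v_k)$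 be an optimal solution of the linear program: maximize $v$ over $(\mathbf p,v)$ subject to $v\le\sum_{i=1}^n p_iu(i,\xi)$ for all $\xi\in\mathcal D_k$; $p_i\ge\delta_i$ for $i=1,\dots,n$; $\sum_{i=1}^n p_i=1$. 3. Set $U_k=v_k$. Choose a Gittins search sequence $\xi_k$ against $\mathbf p_k$ and set $L_k=u(\mathbf p_k)=u(\mathbf p_k,\xi_k)$. 4. If (i) $U_k/L_k-1<\epsilon$ and (ii) none of the constraints $p_i\ge\delta_i$ is binding at $\mathbf p_k$, stop (terminate). Otherwise set $\mathcal D_{k+1}=\mathcal D_k\cup\{\xi_k\}$, and go to step 2 with $k+1$ in place of $k$. *)

theory Defs
  imports "HOL-Library.Extended_Real" "HOL-Library.Infinite_Set"
begin

text \<open>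
  Boxes are the numbers in \<open>{1..n}\<close>; the vectors \<open>t\<close>, \<open>\<alpha>\<close>, \<open>p\<close>, \<open>\<delta>\<close> are functions
  \<open>nat \<Rightarrow> real\<close> of which only the values on \<open>{1..n}\<close> matter. A search sequence is a function
  \<open>\<xi>\<close>, where \<open>\<xi> s\<close> is the box searched in position \<open>s\<close>, positions being counted from 0.
\<close>

definition search_sequences :: "nat \<Rightarrow> (nat \<Rightarrow> nat) set" where
  "search_sequences n = {\<xi>. \<forall>s. \<xi> s \<in> {1..n}}"

text \<open>
  Completion time of the \<open>(r + 1)\<close>-st search of box \<open>i\<close>. It is meaningful when \<open>i\<close> is searched
  infinitely often: then \<open>enumerate {s. \<xi> s = i} r\<close> is the position of that search.
\<close>

definition completion_time :: "(nat \<Rightarrow> real) \<Rightarrow> (nat \<Rightarrow> nat) \<Rightarrow> nat \<Rightarrow> nat \<Rightarrow> real" where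
  "completion_time t \<xi> i r = (\<Sum>s\<le>enumerate {s. \<xi> s = i} r. t (\<xi> s))"

definition u_box :: "(nat \<Rightarrow> real) \<Rightarrow> (nat \<Rightarrow> real) \<Rightarrow> nat \<Rightarrow> (nat \<Rightarrow> nat) \<Rightarrow> ereal" where
  "u_box t \<alpha> i \<xi> =
     (if infinite {s. \<xi> s = i}
      then (\<Sum>r. ereal (\<alpha> i * (1 - \<alpha> i) ^ r * completion_time t \<xi> i r))
      else \<infinity>)"

text \<open>In \<open>ereal\<close>, \<open>0 * \<infinity> = 0\<close>.\<close>

definition u_mixed ::
    "nat \<Rightarrow> (nat \<Rightarrow> real) \<Rightarrow> (nat \<Rightarrow> real) \<Rightarrow> (nat \<Rightarrow> real) \<Rightarrow> (nat \<Rightarrow> nat) \<Rightarrow> ereal" where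
  "u_mixed n t \<alpha> p \<xi> = (\<Sum>i=1..n. ereal (p i) * u_box t \<alpha> i \<xi>)"

definition u_opt :: "nat \<Rightarrow> (nat \<Rightarrow> real) \<Rightarrow> (nat \<Rightarrow> real) \<Rightarrow> (nat \<Rightarrow> real) \<Rightarrow> ereal" where
  "u_opt n t \<alpha> p = (INF \<xi>\<in>search_sequences n. u_mixed n t \<alpha> p \<xi>)"

definition searches_before :: "(nat \<Rightarrow> nat) \<Rightarrow> nat \<Rightarrow> nat \<Rightarrow> nat" where
  "searches_before \<xi> s i = card {s'. s' < s \<and> \<xi> s' = i}"

definition gittins_index ::
    "(nat \<Rightarrow> real) \<Rightarrow> (nat \<Rightarrow> real) \<Rightarrow> (nat \<Rightarrow> real) \<Rightarrow> (nat \<Rightarrow> nat) \<Rightarrow> nat \<Rightarrow> nat \<Rightarrow> real" where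
  "gittins_index t \<alpha> p \<xi> s i = p i * (1 - \<alpha> i) ^ searches_before \<xi> s i * \<alpha> i / t i"

definition gittins_maximal ::
    "nat \<Rightarrow> (nat \<Rightarrow> real) \<Rightarrow> (nat \<Rightarrow> real) \<Rightarrow> (nat \<Rightarrow> real) \<Rightarrow> (nat \<Rightarrow> nat) \<Rightarrow> nat \<Rightarrow> nat \<Rightarrow> bool" where
  "gittins_maximal n t \<alpha> p \<xi> s j \<longleftrightarrow>
     j \<in> {1..n} \<and> (\<forall>i\<in>{1..n}. gittins_index t \<alpha> p \<xi> s i \<le> gittins_index t \<alpha> p \<xi> s j)"

definition gittins_sequences ::
    "nat \<Rightarrow> (nat \<Rightarrow> real) \<Rightarrow> (nat \<Rightarrow> real) \<Rightarrow> (nat \<Rightarrow> real) \<Rightarrow> (nat \<Rightarrow> nat) set" where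
  "gittins_sequences n t \<alpha> p = {\<xi>. \<forall>s. gittins_maximal n t \<alpha> p \<xi> s (\<xi> s)}"

text \<open>
  A preference ordering is a list \<open>ord\<close> containing every box exactly once, the most preferred
  box first; \<open>find\<close> returns the first element of the list with the given property.
\<close>

definition gittins_with_ties ::
    "nat \<Rightarrow> (nat \<Rightarrow> real) \<Rightarrow> (nat \<Rightarrow> real) \<Rightarrow> (nat \<Rightarrow> real) \<Rightarrow> nat list \<Rightarrow> (nat \<Rightarrow> nat) \<Rightarrow> bool" where
  "gittins_with_ties n t \<alpha> p ord \<xi> \<longleftrightarrow>
     (\<forall>s. find (gittins_maximal n t \<alpha> p \<xi> s) ord = Some (\<xi> s))"

definition total_time :: "nat \<Rightarrow> (nat \<Rightarrow> real) \<Rightarrow> (nat \<Rightarrow> real) \<Rightarrow> real" where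
  "total_time n t \<alpha> = (\<Sum>i=1..n. t i / \<alpha> i)"

definition m_const :: "nat \<Rightarrow> (nat \<Rightarrow> real) \<Rightarrow> (nat \<Rightarrow> real) \<Rightarrow> nat \<Rightarrow> nat" where
  "m_const n t \<alpha> i = nat \<lfloor>total_time n t \<alpha> / t i\<rfloor> + 1"

definition c_const :: "nat \<Rightarrow> (nat \<Rightarrow> real) \<Rightarrow> (nat \<Rightarrow> real) \<Rightarrow> nat \<Rightarrow> real" where
  "c_const n t \<alpha> i =
     (\<Sum>j\<in>{1..n} - {i}. t j / (\<alpha> j * (1 - \<alpha> j) ^ (m_const n t \<alpha> j - 1)))"

definition eta :: "nat \<Rightarrow> (nat \<Rightarrow> real) \<Rightarrow> (nat \<Rightarrow> real) \<Rightarrow> nat \<Rightarrow> real" where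
  "eta n t \<alpha> i = (t i / \<alpha> i) / (t i / \<alpha> i + c_const n t \<alpha> i)"

definition p_init :: "nat \<Rightarrow> (nat \<Rightarrow> real) \<Rightarrow> (nat \<Rightarrow> real) \<Rightarrow> nat \<Rightarrow> real" where
  "p_init n t \<alpha> i = (t i / \<alpha> i) / (\<Sum>j=1..n. t j / \<alpha> j)"

text \<open>\<open>rotate k [1..<Suc n]\<close> is the ordering \<open>(k + 1, \<dots>, n, 1, \<dots>, k)\<close>.\<close>

definition initial_sequences ::
    "nat \<Rightarrow> (nat \<Rightarrow> real) \<Rightarrow> (nat \<Rightarrow> real) \<Rightarrow> (nat \<Rightarrow> nat) set" where
  "initial_sequences n t \<alpha> =
     {\<xi>. \<exists>k<n. gittins_with_ties n t \<alpha> (p_init n t \<alpha>) (rotate k [1..<Suc n]) \<xi>}"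

definition lp_feasible ::
    "nat \<Rightarrow> (nat \<Rightarrow> real) \<Rightarrow> (nat \<Rightarrow> real) \<Rightarrow> (nat \<Rightarrow> real) \<Rightarrow> (nat \<Rightarrow> nat) set \<Rightarrow>
     (nat \<Rightarrow> real) \<Rightarrow> real \<Rightarrow> bool" where
  "lp_feasible n t \<alpha> \<delta> D p v \<longleftrightarrow>
     (\<forall>\<xi>\<in>D. ereal v \<le> u_mixed n t \<alpha> p \<xi>) \<and>
     (\<forall>i\<in>{1..n}. p i \<ge> \<delta> i) \<and>
     (\<Sum>i=1..n. p i) = 1"

definition lp_optimal ::
    "nat \<Rightarrow> (nat \<Rightarrow> real) \<Rightarrow> (nat \<Rightarrow> real) \<Rightarrow> (nat \<Rightarrow> real) \<Rightarrow> (nat \<Rightarrow> nat) set \<Rightarrow>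
     (nat \<Rightarrow> real) \<Rightarrow> real \<Rightarrow> bool" where
  "lp_optimal n t \<alpha> \<delta> D p v \<longleftrightarrow>
     lp_feasible n t \<alpha> \<delta> D p v \<and>
     (\<forall>q w. lp_feasible n t \<alpha> \<delta> D q w \<longrightarrow> w \<le> v)"

definition stops ::
    "nat \<Rightarrow> (nat \<Rightarrow> real) \<Rightarrow> (nat \<Rightarrow> real) \<Rightarrow> (nat \<Rightarrow> real) \<Rightarrow> real \<Rightarrow>
     (nat \<Rightarrow> real) \<Rightarrow> real \<Rightarrow> bool" where
  "stops n t \<alpha> \<delta> \<epsilon> p v \<longleftrightarrow>
     ereal v / u_opt n t \<alpha> p - 1 < ereal \<epsilon> \<and> (\<forall>i\<in>{1..n}. p i > \<delta> i)"

text \<open>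
  The sequences \<open>D\<close>, \<open>p\<close>, \<open>v\<close>, \<open>\<xi>\<close> are indexed by the iterations \<open>1, 2, \<dots>\<close>. They are constrained
  only in the iterations actually carried out, i.e. those not preceded by one that stops; so a
  run that stops is represented by any extension of it to infinite sequences.
\<close>

definition algorithm_run ::
    "nat \<Rightarrow> (nat \<Rightarrow> real) \<Rightarrow> (nat \<Rightarrow> real) \<Rightarrow> (nat \<Rightarrow> real) \<Rightarrow> real \<Rightarrow>
     (nat \<Rightarrow> (nat \<Rightarrow> nat) set) \<Rightarrow> (nat \<Rightarrow> nat \<Rightarrow> real) \<Rightarrow> (nat \<Rightarrow> real) \<Rightarrow>
     (nat \<Rightarrow> nat \<Rightarrow> nat) \<Rightarrow> bool" where
  "algorithm_run n t \<alpha> \<delta> \<epsilon> D p v \<xi> \<longleftrightarrow>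
     D 1 = initial_sequences n t \<alpha> \<and>
     (\<forall>k\<ge>1. (\<forall>j\<in>{1..<k}. \<not> stops n t \<alpha> \<delta> \<epsilon> (p j) (v j)) \<longrightarrow>
        lp_optimal n t \<alpha> \<delta> (D k) (p k) (v k) \<and>
        \<xi> k \<in> gittins_sequences n t \<alpha> (p k) \<and>
        (\<not> stops n t \<alpha> \<delta> \<epsilon> (p k) (v k) \<longrightarrow> D (Suc k) = D k \<union> {\<xi> k}))"

end

theory Submission
  imports Defs "HOL-Analysis.Nonnegative_Lebesgue_Integration"
begin

text \<open>
  Write \<open>M\<close> for \<open>total_time\<close>. The expected time of a search sequence is the sum, over all positions,
  of the search time there multiplied by the probability that the hider is still undetected. A
  Gittins search of duration \<open>\<tau>\<close> lowers this probability \<open>W\<close> by at least \<open>\<tau> W / M\<close>, so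
  the expected time of a Gittins sequence is at most \<open>M\<close>, by telescoping. Hence against any \<open>p \<ge> \<delta>\<close>
  the quantities \<open>u(i, \<xi>)\<close> of a Gittins sequence \<open>\<xi>\<close> are bounded by \<open>M / \<delta> i\<close>.

  If the algorithm ran forever, the bounded points \<open>(p k, v k)\<close> would include two arbitrarily close
  ones, in iterations \<open>k < k'\<close>. The constraint that \<open>\<xi> k\<close> contributes to the linear program of
  iteration \<open>k'\<close> gives \<open>v k' \<le> u(p k', \<xi> k)\<close>, which is close to \<open>u(p k, \<xi> k) = u(p k)\<close>; so
  \<open>v k\<close> exceeds \<open>u(p k)\<close> by arbitrarily little. But if some \<open>p k i\<close> were equal to
  \<open>\<delta> i < \<eta> i\<close>, then moving a fixed amount of mass to the boxes with such small probabilities,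
  which Gittins sequences search so late that \<open>u(i, \<xi>) > M\<close>, would show that \<open>v k\<close> exceeds \<open>u(p k)\<close>
  by a fixed amount.
\<close>

section \<open>Infinite sums of nonnegative terms\<close>

lemma suminf_swap_ennreal:
  fixes f :: "nat \<Rightarrow> nat \<Rightarrow> ennreal"
  shows "(\<Sum>i. \<Sum>j. f i j) = (\<Sum>j. \<Sum>i. f i j)"
proof -
  have "(\<Sum>j. \<Sum>i. f i j) = (\<integral>\<^sup>+j. (\<Sum>i. f i j) \<partial>count_space UNIV)"
    by (simp add: nn_integral_count_space_nat)
  also have "\<dots> = (\<Sum>i. \<integral>\<^sup>+j. f i j \<partial>count_space UNIV)"
    by (rule nn_integral_suminf) simp
  finally show ?thesis
    by (simp add: nn_integral_count_space_nat)
qed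

lemma suminf_const_ennreal_eq_top:
  fixes c :: ennreal
  assumes "c > 0"
  shows "(\<Sum>_::nat. c) = top"
proof -
  have "(\<Sum>_::nat. c) = nn_integral (count_space (UNIV :: nat set)) (\<lambda>_. c)"
    by (rule nn_integral_count_space_nat[symmetric])
  also have "\<dots> = top"
    using assms by (simp add: ennreal_mult_eq_top_iff)
  finally show ?thesis .
qed

section \<open>Counting the searches of a box\<close>

lemma searches_before_0 [simp]: "searches_before \<xi> 0 i = 0"
  by (simp add: searches_before_def)

lemma searches_before_Suc:
  "searches_before \<xi> (Suc s) i = searches_before \<xi> s i + (if \<xi> s = i then 1 else 0)"
proof -
  have "{s'. s' < Suc s \<and> \<xi> s' = i} =
      (if \<xi> s = i then insert s {s'. s' < s \<and> \<xi> s' = i} else {s'. s' < s \<and> \<xi> s' = i})"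
    by (auto simp: less_Suc_eq)
  then show ?thesis
    by (simp add: searches_before_def)
qed

lemma searches_before_mono: "s \<le> s' \<Longrightarrow> searches_before \<xi> s i \<le> searches_before \<xi> s' i"
  unfolding searches_before_def by (rule card_mono) auto

lemma searches_before_enumerate:
  assumes "infinite {s. \<xi> s = i}"
  shows "searches_before \<xi> (enumerate {s. \<xi> s = i} r) i = r"
proof -
  let ?S = "{s. \<xi> s = i}"
  have "{s'. s' < enumerate ?S r \<and> \<xi> s' = i} = enumerate ?S ` {..<r}" (is "?L = ?R")
  proof (intro set_eqI iffI)
    fix x assume x: "x \<in> ?L"
    then obtain q where "enumerate ?S q = x"
      using enumerate_Ex[OF assms, of x] by auto
    with x assms show "x \<in> ?R"
      by auto
  next
    fix x assume "x \<in> ?R"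
    then obtain q where q: "q < r" "x = enumerate ?S q"
      by auto
    then show "x \<in> ?L"
      using enumerate_in_set[OF assms, of q] assms by auto
  qed
  moreover have "card (enumerate ?S ` {..<r}) = r"
    using inj_enumerate[OF assms] by (simp add: card_image inj_on_subset)
  ultimately show ?thesis
    by (simp add: searches_before_def)
qed

text \<open>Searches are counted from 0: exactly \<open>r\<close> of them precede position
  \<open>enumerate {s. \<xi> s = i} r\<close>, and there are \<open>r + 1\<close> just after it.
  This turns a cut-off in positions into a cut-off in \<open>r\<close>.\<close>

lemma le_enumerate_iff_searches_before_le:
  assumes "infinite {s. \<xi> s = i}"
  shows "s \<le> enumerate {s. \<xi> s = i} r \<longleftrightarrow> searches_before \<xi> s i \<le> r"
proof
  assume "s \<le> enumerate {s. \<xi> s = i} r"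
  then show "searches_before \<xi> s i \<le> r"
    using searches_before_mono[of s _ \<xi> i] searches_before_enumerate[OF assms] by metis
next
  assume le: "searches_before \<xi> s i \<le> r"
  show "s \<le> enumerate {s. \<xi> s = i} r"
  proof (rule ccontr)
    let ?e = "enumerate {s. \<xi> s = i} r"
    assume "\<not> s \<le> ?e"
    then have "searches_before \<xi> (Suc ?e) i \<le> searches_before \<xi> s i"
      by (intro searches_before_mono) simp
    moreover have "\<xi> ?e = i"
      using enumerate_in_set[OF assms, of r] by simp
    ultimately show False
      using le searches_before_enumerate[OF assms, of r] by (simp add: searches_before_Suc)
  qed
qed

section \<open>Uniform bounds and the pigeonhole principle\<close>

lemma finite_pos_lower_bound:
  fixes f :: "'a \<Rightarrow> real"
  assumes "finite A" and "\<And>a. a \<in> A \<Longrightarrow> f a > 0"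
  shows "\<exists>s>0. \<forall>a\<in>A. s < f a"
  using assms
proof (induction A rule: finite_induct)
  case empty
  then show ?case
    by (auto intro: exI[of _ 1])
next
  case (insert a A)
  then obtain s where s: "s > 0" "\<forall>a\<in>A. s < f a"
    by auto
  moreover have "f a > 0"
    using insert.prems by simp
  ultimately have "min s (f a / 2) > 0 \<and> (\<forall>b\<in>insert a A. min s (f a / 2) < f b)"
    by (auto simp: min_less_iff_disj)
  then show ?case
    by blast
qed

lemma abs_diff_less_of_floor_eq:
  fixes x y h :: real
  assumes "h > 0" and "\<lfloor>x / h\<rfloor> = \<lfloor>y / h\<rfloor>"
  shows "\<bar>x - y\<bar> < h"
proof -
  have "\<bar>x / h - y / h\<bar> < 1"
    using assms(2) by linarith
  then have "\<bar>x - y\<bar> / h < 1"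
    using assms(1) by (simp add: diff_divide_distrib[symmetric])
  then show ?thesis
    using assms(1) by simp
qed

text \<open>Cut space into cells of side \<open>h\<close>. A bounded set meets finitely many of
  them, so some cell contains infinitely many of the points.\<close>

lemma ex_close_pair:
  fixes x :: "nat \<Rightarrow> 'i \<Rightarrow> real"
  assumes "finite I" and "h > 0"
    and bound: "\<And>k i. k \<ge> m \<Longrightarrow> i \<in> I \<Longrightarrow> \<bar>x k i\<bar> \<le> C"
  shows "\<exists>k k'. m \<le> k \<and> k < k' \<and> (\<forall>i\<in>I. \<bar>x k i - x k' i\<bar> < h)"
proof -
  define g where "g = (\<lambda>k. restrict (\<lambda>i. \<lfloor>x k i / h\<rfloor>) I)"
  have "\<lfloor>x k i / h\<rfloor> \<in> {\<lfloor>- C / h\<rfloor>..\<lfloor>C / h\<rfloor>}" if "k \<ge> m" "i \<in> I" for k i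
  proof -
    have "- C \<le> x k i" "x k i \<le> C"
      using bound[OF that] by auto
    then have "- C / h \<le> x k i / h" "x k i / h \<le> C / h"
      using \<open>h > 0\<close> by (simp_all only: divide_right_mono less_imp_le)
    then show ?thesis
      by (auto intro: floor_mono)
  qed
  then have "g ` {m..} \<subseteq> PiE I (\<lambda>_. {\<lfloor>- C / h\<rfloor>..\<lfloor>C / h\<rfloor>})"
    by (auto simp: g_def)
  then have "finite (g ` {m..})"
    by (rule finite_subset) (simp add: finite_PiE \<open>finite I\<close>)
  then obtain k where k: "k \<ge> m" "infinite {k' \<in> {m..}. g k' = g k}"
    using pigeonhole_infinite[of "{m..}" g] infinite_Ici by auto
  then obtain k' where k': "k' > k" "g k' = g k"
    using infinite_nat_iff_unbounded[of "{k' \<in> {m..}. g k' = g k}"] by auto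
  have "\<bar>x k i - x k' i\<bar> < h" if "i \<in> I" for i
    using abs_diff_less_of_floor_eq[OF \<open>h > 0\<close>, of "x k i" "x k' i"] fun_cong[OF k'(2), of i] that
    by (simp add: g_def)
  with k k' show ?thesis
    by blast
qed

section \<open>Expected search times as sums over positions\<close>

locale search_game =
  fixes n :: nat and t \<alpha> :: "nat \<Rightarrow> real"
  assumes n_pos: "n \<ge> 1"
    and t_pos: "\<And>i. i \<in> {1..n} \<Longrightarrow> t i > 0"
    and \<alpha>_bounds: "\<And>i. i \<in> {1..n} \<Longrightarrow> 0 < \<alpha> i \<and> \<alpha> i < 1"
begin

definition t_min :: real where "t_min = Min (t ` {1..n})"

lemma t_min_pos: "t_min > 0"
  using n_pos t_pos by (auto simp: t_min_def Min_gr_iff)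

lemma t_min_le: "i \<in> {1..n} \<Longrightarrow> t_min \<le> t i"
  by (auto simp: t_min_def)

text \<open>For a mixed strategy \<open>p\<close>, the probability that the hider is in box
  \<open>fst a\<close> and is found by search number \<open>snd a\<close> of that box, counting from
  0.\<close>

definition mass :: "(nat \<Rightarrow> real) \<Rightarrow> nat \<times> nat \<Rightarrow> real" where
  "mass p a = p (fst a) * \<alpha> (fst a) * (1 - \<alpha> (fst a)) ^ snd a"

text \<open>The probability that all searches in positions before \<open>s\<close> fail.\<close>

definition undetected :: "(nat \<Rightarrow> real) \<Rightarrow> (nat \<Rightarrow> nat) \<Rightarrow> nat \<Rightarrow> real" where
  "undetected p \<xi> s = (\<Sum>i=1..n. p i * (1 - \<alpha> i) ^ searches_before \<xi> s i)"

text \<open>Names a search independently of its position, so that the searches of different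
  sequences can be matched.\<close>

definition search_at :: "(nat \<Rightarrow> nat) \<Rightarrow> nat \<Rightarrow> nat \<times> nat" where
  "search_at \<xi> s = (\<xi> s, searches_before \<xi> s (\<xi> s))"

text \<open>The search in position \<open>s\<close> takes place only if all earlier searches of box
  \<open>i\<close> failed. Formally, the sums over \<open>r\<close> and over positions are
  exchanged.\<close>

lemma u_box_eq:
  assumes i: "i \<in> {1..n}" and \<xi>: "\<xi> \<in> search_sequences n"
  shows "u_box t \<alpha> i \<xi> =
    enn2ereal (\<Sum>s. ennreal (t (\<xi> s) * (1 - \<alpha> i) ^ searches_before \<xi> s i))"
proof -
  have \<xi>s: "\<xi> s \<in> {1..n}" for s
    using \<xi> by (simp add: search_sequences_def)
  have t0: "0 \<le> t (\<xi> s)" for s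
    using t_pos[OF \<xi>s] by (simp add: less_imp_le)
  let ?a = "\<alpha> i"
  have a: "0 < ?a" "?a < 1"
    using \<alpha>_bounds[OF i] by auto
  show ?thesis
  proof (cases "infinite {s. \<xi> s = i}")
    case True
    let ?e = "enumerate {s. \<xi> s = i}"
    \<comment> \<open>A geometric tail: the terms with \<open>r\<close> below
      \<open>searches_before \<xi> s i\<close> vanish, and shifting past them leaves a full
      geometric series.\<close>
    have tail: "(\<Sum>r. ennreal (if s \<le> ?e r then ?a * (1 - ?a) ^ r else 0)) =
        ennreal ((1 - ?a) ^ searches_before \<xi> s i)" for s
    proof -
      let ?N = "searches_before \<xi> s i"
      have "(\<lambda>r. ?a * (1 - ?a) ^ (r + ?N)) sums ((1 - ?a) ^ ?N)"
        using sums_mult[OF geometric_sums[of "1 - ?a"], of "?a * (1 - ?a) ^ ?N"] a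
        by (simp add: power_add mult_ac)
      then have "(\<lambda>r. if s \<le> ?e (r + ?N) then ?a * (1 - ?a) ^ (r + ?N) else 0) sums ((1 - ?a) ^ ?N)"
        by (simp add: le_enumerate_iff_searches_before_le[OF True])
      then have "(\<lambda>r. if s \<le> ?e r then ?a * (1 - ?a) ^ r else 0) sums ((1 - ?a) ^ ?N)"
        by (subst (asm) sums_zero_iff_shift)
           (simp_all add: le_enumerate_iff_searches_before_le[OF True])
      then show ?thesis
        using a by (intro suminf_ennreal_eq) auto
    qed
    have "u_box t \<alpha> i \<xi> = (\<Sum>r. ereal (?a * (1 - ?a) ^ r * completion_time t \<xi> i r))"
      using True by (simp add: u_box_def)
    also have "\<dots> = (\<Sum>r. enn2ereal (\<Sum>s. ennreal (t (\<xi> s) * (if s \<le> ?e r then ?a * (1 - ?a) ^ r else 0))))"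
    proof (intro suminf_cong)
      fix r
      have "(\<Sum>s. ennreal (t (\<xi> s) * (if s \<le> ?e r then ?a * (1 - ?a) ^ r else 0))) =
          (\<Sum>s\<le>?e r. ennreal (t (\<xi> s) * (if s \<le> ?e r then ?a * (1 - ?a) ^ r else 0)))"
        by (rule suminf_finite) auto
      also have "\<dots> = (\<Sum>s\<le>?e r. ennreal (?a * (1 - ?a) ^ r * t (\<xi> s)))"
        by (intro sum.cong) (auto simp: mult_ac)
      also have "\<dots> = ennreal (?a * (1 - ?a) ^ r * completion_time t \<xi> i r)"
        using a t0 by (simp add: sum_ennreal completion_time_def sum_distrib_left)
      finally show "ereal (?a * (1 - ?a) ^ r * completion_time t \<xi> i r) =
          enn2ereal (\<Sum>s. ennreal (t (\<xi> s) * (if s \<le> ?e r then ?a * (1 - ?a) ^ r else 0)))"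
        using a t0 by (simp add: completion_time_def sum_nonneg)
    qed
    also have "\<dots> = enn2ereal (\<Sum>r. \<Sum>s. ennreal (t (\<xi> s) * (if s \<le> ?e r then ?a * (1 - ?a) ^ r else 0)))"
      by simp
    also have "(\<Sum>r. \<Sum>s. ennreal (t (\<xi> s) * (if s \<le> ?e r then ?a * (1 - ?a) ^ r else 0))) =
        (\<Sum>s. \<Sum>r. ennreal (t (\<xi> s) * (if s \<le> ?e r then ?a * (1 - ?a) ^ r else 0)))"
      by (rule suminf_swap_ennreal)
    also have "\<dots> = (\<Sum>s. ennreal (t (\<xi> s)) * (\<Sum>r. ennreal (if s \<le> ?e r then ?a * (1 - ?a) ^ r else 0)))"
      using a t0 by (subst ennreal_suminf_cmult[symmetric], intro suminf_cong)
        (simp add: ennreal_mult' del: ennreal_suminf_cmult)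
    also have "\<dots> = (\<Sum>s. ennreal (t (\<xi> s) * (1 - \<alpha> i) ^ searches_before \<xi> s i))"
      unfolding tail using a t0 by (simp add: ennreal_mult')
    finally show ?thesis .
  next
    case False
    \<comment> \<open>With finitely many searches of box \<open>i\<close>, every summand is at least
      this constant, so the sum diverges, in agreement with the value \<infinity> of
      \<open>u_box\<close>.\<close>
    let ?c = "t_min * (1 - ?a) ^ card {s. \<xi> s = i}"
    have "?c > 0"
      using t_min_pos a by simp
    have "ennreal ?c \<le> ennreal (t (\<xi> s) * (1 - ?a) ^ searches_before \<xi> s i)" for s
    proof (intro ennreal_leI mult_mono power_decreasing)
      show "searches_before \<xi> s i \<le> card {s. \<xi> s = i}"
        unfolding searches_before_def using False by (intro card_mono) auto
    qed (use a t0 t_min_le[OF \<xi>s] in auto)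
    then have "(\<Sum>_::nat. ennreal ?c) \<le>
        (\<Sum>s. ennreal (t (\<xi> s) * (1 - ?a) ^ searches_before \<xi> s i))"
      by (intro suminf_le summableI)
    then have "(\<Sum>s. ennreal (t (\<xi> s) * (1 - ?a) ^ searches_before \<xi> s i)) = top"
      using \<open>?c > 0\<close> by (simp add: suminf_const_ennreal_eq_top top_unique)
    then show ?thesis
      using False by (simp add: u_box_def)
  qed
qed

lemma u_mixed_eq:
  assumes p: "\<And>i. i \<in> {1..n} \<Longrightarrow> 0 \<le> p i" and \<xi>: "\<xi> \<in> search_sequences n"
  shows "u_mixed n t \<alpha> p \<xi> = enn2ereal (\<Sum>s. ennreal (t (\<xi> s) * undetected p \<xi> s))"
proof -
  have \<xi>s: "\<xi> s \<in> {1..n}" for s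
    using \<xi> by (simp add: search_sequences_def)
  have t0: "0 \<le> t (\<xi> s)" for s
    using t_pos[OF \<xi>s] by (simp add: less_imp_le)
  let ?f = "\<lambda>i s. ennreal (t (\<xi> s) * (1 - \<alpha> i) ^ searches_before \<xi> s i)"
  have "u_mixed n t \<alpha> p \<xi> = (\<Sum>i=1..n. enn2ereal (ennreal (p i) * (\<Sum>s. ?f i s)))"
    unfolding u_mixed_def using p \<xi>
    by (intro sum.cong) (simp_all add: u_box_eq times_ennreal.rep_eq)
  also have "\<dots> = enn2ereal (\<Sum>i=1..n. \<Sum>s. ennreal (p i) * ?f i s)"
    by simp
  also have "(\<Sum>i=1..n. \<Sum>s. ennreal (p i) * ?f i s) = (\<Sum>s. \<Sum>i=1..n. ennreal (p i) * ?f i s)"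
    by (rule suminf_sum[symmetric]) (rule summableI)
  also have "\<dots> = (\<Sum>s. ennreal (t (\<xi> s) * undetected p \<xi> s))"
  proof (intro suminf_cong)
    fix s
    have "(\<Sum>i=1..n. ennreal (p i) * ?f i s) =
        (\<Sum>i=1..n. ennreal (p i * (t (\<xi> s) * (1 - \<alpha> i) ^ searches_before \<xi> s i)))"
      using p by (intro sum.cong) (simp_all add: ennreal_mult')
    also have "\<dots> = ennreal (\<Sum>i=1..n. p i * (t (\<xi> s) * (1 - \<alpha> i) ^ searches_before \<xi> s i))"
      using p t0 \<alpha>_bounds by (intro sum_ennreal) (simp add: less_imp_le)
    also have "\<dots> = ennreal (t (\<xi> s) * undetected p \<xi> s)"
      by (simp add: undetected_def sum_distrib_left mult_ac)
    finally show "(\<Sum>i=1..n. ennreal (p i) * ?f i s) = ennreal (t (\<xi> s) * undetected p \<xi> s)" .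
  qed
  finally show ?thesis .
qed

text \<open>Box \<open>i\<close> is first searched at \<open>s0\<close> or later, so every search up
  to \<open>s0\<close> takes place with probability 1.\<close>

lemma u_box_ge:
  assumes i: "i \<in> {1..n}" and \<xi>: "\<xi> \<in> search_sequences n"
    and s0: "searches_before \<xi> s0 i = 0"
  shows "ereal (\<Sum>s\<le>s0. t (\<xi> s)) \<le> u_box t \<alpha> i \<xi>"
proof -
  have t0: "0 \<le> t (\<xi> s)" for s
    using t_pos[of "\<xi> s"] \<xi> by (simp add: search_sequences_def less_imp_le)
  have "searches_before \<xi> s i = 0" if "s \<le> s0" for s
    using searches_before_mono[OF that, of \<xi> i] s0 by simp
  then have "ennreal (\<Sum>s\<le>s0. t (\<xi> s)) =
      (\<Sum>s\<le>s0. ennreal (t (\<xi> s) * (1 - \<alpha> i) ^ searches_before \<xi> s i))"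
    using t0 by simp
  also have "\<dots> \<le> (\<Sum>s. ennreal (t (\<xi> s) * (1 - \<alpha> i) ^ searches_before \<xi> s i))"
    by (rule sum_le_suminf) auto
  finally show ?thesis
    using t0 by (simp add: u_box_eq[OF i \<xi>] less_eq_ennreal.rep_eq sum_nonneg)
qed

lemma u_box_ge_t_min:
  assumes "i \<in> {1..n}" and "\<xi> \<in> search_sequences n"
  shows "ereal t_min \<le> u_box t \<alpha> i \<xi>"
proof -
  have "ereal t_min \<le> ereal (\<Sum>s\<le>0. t (\<xi> s))"
    using assms(2) t_min_le[of "\<xi> 0"] by (simp add: search_sequences_def)
  also have "\<dots> \<le> u_box t \<alpha> i \<xi>"
    using assms by (intro u_box_ge) auto
  finally show ?thesis .
qed

text \<open>The bound is asked only on the support of \<open>q\<close>, as it will be applied to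
  mass concentrated on boxes searched late.\<close>

lemma u_mixed_ge:
  assumes q: "\<And>i. i \<in> {1..n} \<Longrightarrow> 0 \<le> q i" and sum: "(\<Sum>i=1..n. q i) = 1"
    and u: "\<And>i. i \<in> {1..n} \<Longrightarrow> 0 < q i \<Longrightarrow> ereal c \<le> u_box t \<alpha> i \<xi>"
  shows "ereal c \<le> u_mixed n t \<alpha> q \<xi>"
proof -
  have "ereal c = (\<Sum>i=1..n. ereal (q i) * ereal c)"
    using sum by (simp flip: sum_distrib_right)
  also have "\<dots> \<le> u_mixed n t \<alpha> q \<xi>"
    unfolding u_mixed_def
  proof (rule sum_mono)
    fix i assume i: "i \<in> {1..n}"
    then show "ereal (q i) * ereal c \<le> ereal (q i) * u_box t \<alpha> i \<xi>"
      using q[OF i] u[OF i]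
      by (cases "q i = 0") (auto simp flip: zero_ereal_def simp del: times_ereal.simps intro!: ereal_mult_left_mono)
  qed
  finally show ?thesis .
qed

lemma u_box_nonneg:
  assumes "i \<in> {1..n}" and "\<xi> \<in> search_sequences n"
  shows "0 \<le> u_box t \<alpha> i \<xi>"
  using u_box_ge_t_min[OF assms] t_min_pos by (metis ereal_less_eq(5) less_imp_le order_trans)

section \<open>Gittins sequences: bounded cost, existence, late searches\<close>

lemma gittins_sequences_subset: "gittins_sequences n t \<alpha> p \<subseteq> search_sequences n"
  by (auto simp: gittins_sequences_def search_sequences_def gittins_maximal_def)

lemma undetected_Suc:
  assumes "\<xi> \<in> search_sequences n"
  shows "undetected p \<xi> s - undetected p \<xi> (Suc s) = mass p (search_at \<xi> s)"
proof -
  have \<xi>s: "\<xi> s \<in> {1..n}"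
    using assms by (simp add: search_sequences_def)
  have "undetected p \<xi> s - undetected p \<xi> (Suc s) =
      (\<Sum>i=1..n. if \<xi> s = i then mass p (search_at \<xi> s) else 0)"
    unfolding undetected_def sum_subtractf[symmetric]
    by (intro sum.cong) (auto simp: searches_before_Suc mass_def search_at_def algebra_simps)
  also have "\<dots> = mass p (search_at \<xi> s)"
    using \<xi>s by simp
  finally show ?thesis .
qed

text \<open>Box \<open>i\<close> contributes its index times \<open>t i / \<alpha> i\<close> to
  \<open>undetected\<close>. Replacing each index by the maximal one leaves the sum of these
  weights, which is \<open>total_time\<close>.\<close>

lemma gittins_greedy:
  assumes \<xi>: "\<xi> \<in> gittins_sequences n t \<alpha> p"
  shows "t (\<xi> s) * undetected p \<xi> s \<le> total_time n t \<alpha> * mass p (search_at \<xi> s)"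
proof -
  let ?g = "gittins_index t \<alpha> p \<xi> s"
  have \<xi>s: "\<xi> s \<in> {1..n}"
    using \<xi> gittins_sequences_subset by (auto simp: search_sequences_def)
  have max: "?g i \<le> ?g (\<xi> s)" if "i \<in> {1..n}" for i
    using \<xi> that by (simp add: gittins_sequences_def gittins_maximal_def)
  have "undetected p \<xi> s = (\<Sum>i=1..n. ?g i * (t i / \<alpha> i))"
    unfolding undetected_def
  proof (intro sum.cong refl)
    fix i assume i: "i \<in> {1..n}"
    then show "p i * (1 - \<alpha> i) ^ searches_before \<xi> s i = ?g i * (t i / \<alpha> i)"
      using t_pos[OF i] \<alpha>_bounds[OF i] by (simp add: gittins_index_def)
  qed
  also have "\<dots> \<le> (\<Sum>i=1..n. ?g (\<xi> s) * (t i / \<alpha> i))"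
    using t_pos \<alpha>_bounds max by (intro sum_mono mult_right_mono) (auto simp: less_imp_le)
  also have "\<dots> = ?g (\<xi> s) * total_time n t \<alpha>"
    by (simp add: total_time_def sum_distrib_left)
  finally have "t (\<xi> s) * undetected p \<xi> s \<le> t (\<xi> s) * (?g (\<xi> s) * total_time n t \<alpha>)"
    using t_pos[OF \<xi>s] by (intro mult_left_mono) auto
  also have "\<dots> = total_time n t \<alpha> * mass p (search_at \<xi> s)"
    using t_pos[OF \<xi>s] by (simp add: gittins_index_def mass_def search_at_def)
  finally show ?thesis .
qed

lemma undetected_nonneg:
  assumes "\<And>i. i \<in> {1..n} \<Longrightarrow> 0 \<le> p i"
  shows "0 \<le> undetected p \<xi> s"
  unfolding undetected_def using assms \<alpha>_bounds
  by (intro sum_nonneg mult_nonneg_nonneg zero_le_power) (auto simp: less_imp_le)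

lemma total_time_pos: "total_time n t \<alpha> > 0"
  unfolding total_time_def using n_pos t_pos \<alpha>_bounds by (intro sum_pos) auto

lemma gittins_u_mixed_le:
  assumes p: "\<And>i. i \<in> {1..n} \<Longrightarrow> 0 \<le> p i" and sum: "(\<Sum>i=1..n. p i) = 1"
    and \<xi>: "\<xi> \<in> gittins_sequences n t \<alpha> p"
  shows "u_mixed n t \<alpha> p \<xi> \<le> ereal (total_time n t \<alpha>)"
proof -
  let ?M = "total_time n t \<alpha>"
  have \<xi>': "\<xi> \<in> search_sequences n"
    using \<xi> gittins_sequences_subset by blast
  have t0: "0 \<le> t (\<xi> s)" for s
    using t_pos[of "\<xi> s"] \<xi>' by (simp add: search_sequences_def less_imp_le)
  have "(\<Sum>s. ennreal (t (\<xi> s) * undetected p \<xi> s)) + 0 \<le> ennreal ?M"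
  proof (rule ennreal_suminf_bound_add)
    fix m
    have "(\<Sum>s<m. t (\<xi> s) * undetected p \<xi> s) \<le>
        (\<Sum>s<m. ?M * (undetected p \<xi> s - undetected p \<xi> (Suc s)))"
      by (intro sum_mono) (simp add: undetected_Suc[OF \<xi>'] gittins_greedy[OF \<xi>])
    also have "\<dots> = ?M * (undetected p \<xi> 0 - undetected p \<xi> m)"
      by (simp add: sum_distrib_left[symmetric] sum_lessThan_telescope')
    also have "\<dots> \<le> ?M * undetected p \<xi> 0"
      using undetected_nonneg[OF p] total_time_pos by (intro mult_left_mono) auto
    also have "\<dots> = ?M"
      using sum by (simp add: undetected_def)
    finally have "ennreal (\<Sum>s<m. t (\<xi> s) * undetected p \<xi> s) \<le> ennreal ?M"
      by (rule ennreal_leI)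
    then show "(\<Sum>s<m. ennreal (t (\<xi> s) * undetected p \<xi> s)) + 0 \<le> ennreal ?M"
      using undetected_nonneg[OF p] t0 by (simp add: sum_ennreal)
  qed
  then have "enn2ereal (\<Sum>s. ennreal (t (\<xi> s) * undetected p \<xi> s)) \<le> enn2ereal (ennreal ?M)"
    by (simp add: less_eq_ennreal.rep_eq)
  moreover have "u_mixed n t \<alpha> p \<xi> = enn2ereal (\<Sum>s. ennreal (t (\<xi> s) * undetected p \<xi> s))"
    by (rule u_mixed_eq) (use p \<xi>' in auto)
  ultimately show ?thesis
    using total_time_pos by (simp add: less_imp_le)
qed

lemma ex_gittins: "\<exists>\<xi>. \<xi> \<in> gittins_sequences n t \<alpha> p"
proof -
  let ?g = "\<lambda>m i. p i * (1 - \<alpha> i) ^ m i * \<alpha> i / t i"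
  have "\<exists>j. j \<in> {1..n} \<and> (\<forall>i\<in>{1..n}. ?g m i \<le> ?g m j)" for m :: "nat \<Rightarrow> nat"
  proof -
    have "Max (?g m ` {1..n}) \<in> ?g m ` {1..n}"
      using n_pos by (intro Max_in) auto
    then obtain j where j: "j \<in> {1..n}" "Max (?g m ` {1..n}) = ?g m j"
      by auto
    moreover have "?g m i \<le> ?g m j" if "i \<in> {1..n}" for i
      unfolding j(2)[symmetric] using that by (intro Max_ge) auto
    ultimately show ?thesis
      by blast
  qed
  then obtain J where J: "J m \<in> {1..n}" "\<And>i. i \<in> {1..n} \<Longrightarrow> ?g m i \<le> ?g m (J m)" for m
    by metis
  \<comment> \<open>\<open>c s\<close> is the vector of search counts before position
    \<open>s\<close>; the next box depends on the past only through it.\<close>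
  define c where "c = rec_nat (\<lambda>_. 0) (\<lambda>_ m. m(J m := Suc (m (J m))))"
  define \<xi> where "\<xi> = (\<lambda>s. J (c s))"
  have c: "searches_before \<xi> s i = c s i" for s i
  proof (induction s)
    case (Suc s)
    then show ?case
      by (auto simp: searches_before_Suc c_def \<xi>_def)
  qed (simp add: c_def)
  have "\<xi> \<in> gittins_sequences n t \<alpha> p"
    using J by (simp add: gittins_sequences_def gittins_maximal_def gittins_index_def c)
      (simp add: \<xi>_def)
  then show ?thesis
    by blast
qed

text \<open>Some other box \<open>j\<close> is searched \<open>m_const n t \<alpha> j\<close> times before box \<open>i\<close> is searched at all,
  and these searches alone take longer than \<open>total_time n t \<alpha>\<close>.\<close>

lemma gittins_late_search:
  assumes p: "\<And>i. i \<in> {1..n} \<Longrightarrow> 0 \<le> p i" and sum: "(\<Sum>i=1..n. p i) = 1"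
    and \<xi>: "\<xi> \<in> gittins_sequences n t \<alpha> p"
    and i: "i \<in> {1..n}" and small: "p i < eta n t \<alpha> i"
  shows "ereal (total_time n t \<alpha> + t_min) \<le> u_box t \<alpha> i \<xi>"
proof (cases "finite {s. \<xi> s = i}")
  case True
  then show ?thesis
    by (simp add: u_box_def)
next
  case False
  let ?m = "m_const n t \<alpha>" and ?M = "total_time n t \<alpha>"
  have \<xi>': "\<xi> \<in> search_sequences n"
    using \<xi> gittins_sequences_subset by blast
  have \<xi>s: "\<xi> s \<in> {1..n}" for s
    using \<xi>' by (simp add: search_sequences_def)
  have ti: "t i > 0" and ai: "0 < \<alpha> i" "\<alpha> i < 1"
    using t_pos[OF i] \<alpha>_bounds[OF i] by auto
  have c0: "0 \<le> c_const n t \<alpha> i"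
    unfolding c_const_def using t_pos \<alpha>_bounds
    by (intro sum_nonneg divide_nonneg_nonneg mult_nonneg_nonneg zero_le_power) (auto simp: less_imp_le)
  \<comment> \<open>The index of \<open>i\<close> before its first search is compared with that of
    \<open>j\<close> after \<open>?m j - 1\<close> searches. If no \<open>j\<close> won, each
    \<open>p j\<close> would be bounded by a multiple of \<open>p i\<close>; the bounds sum to the
    term with \<open>c_const\<close>, giving 1 \<le> \<open>p i / eta n t \<alpha> i\<close>,
    against \<open>small\<close>.\<close>
  have "\<exists>j\<in>{1..n}-{i}. p i * \<alpha> i / t i < p j * (1 - \<alpha> j) ^ (?m j - 1) * \<alpha> j / t j"
  proof (rule ccontr)
    assume "\<not> ?thesis"
    then have le: "p j * (1 - \<alpha> j) ^ (?m j - 1) * \<alpha> j / t j \<le> p i * \<alpha> i / t i"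
      if "j \<in> {1..n} - {i}" for j
      using that by force
    have le': "p j \<le> p i * \<alpha> i / t i * (t j / (\<alpha> j * (1 - \<alpha> j) ^ (?m j - 1)))" if j: "j \<in> {1..n} - {i}" for j
    proof -
      have "t j > 0" "\<alpha> j > 0" "\<alpha> j \<noteq> 1" "(1 - \<alpha> j) ^ (?m j - 1) > 0"
        using t_pos[of j] \<alpha>_bounds[of j] j by auto
      moreover from this have "p j = p j * (1 - \<alpha> j) ^ (?m j - 1) * \<alpha> j / t j *
          (t j / (\<alpha> j * (1 - \<alpha> j) ^ (?m j - 1)))"
        by simp
      ultimately show ?thesis
        using mult_right_mono[OF le[OF j], of "t j / (\<alpha> j * (1 - \<alpha> j) ^ (?m j - 1))"]
        by (metis divide_nonneg_nonneg less_imp_le mult_nonneg_nonneg)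
    qed
    have "(\<Sum>j\<in>{1..n}-{i}. p j) \<le> p i * \<alpha> i / t i * c_const n t \<alpha> i"
      unfolding c_const_def sum_distrib_left by (rule sum_mono) (rule le')
    moreover have "(\<Sum>j=1..n. p j) = p i + (\<Sum>j\<in>{1..n}-{i}. p j)"
      using i by (intro sum.remove) auto
    ultimately have "1 \<le> p i + p i * \<alpha> i / t i * c_const n t \<alpha> i"
      using sum by simp
    also have "\<dots> = p i * ((t i / \<alpha> i + c_const n t \<alpha> i) / (t i / \<alpha> i))"
      using ti ai by (simp add: field_simps)
    also have "\<dots> < 1"
    proof -
      have "t i / \<alpha> i + c_const n t \<alpha> i > 0"
        using ti ai c0 by (simp add: add_pos_nonneg)
      then have "p i * (t i / \<alpha> i + c_const n t \<alpha> i) < t i / \<alpha> i"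
        using small unfolding eta_def by (simp only: pos_less_divide_eq)
      then have "p i * (t i / \<alpha> i + c_const n t \<alpha> i) / (t i / \<alpha> i) < 1"
        using ti ai by (subst divide_less_eq_1_pos) auto
      then show ?thesis
        by (simp only: times_divide_eq_right)
    qed
    finally show False by simp
  qed
  then obtain j where j: "j \<in> {1..n}"
    and ji: "p i * \<alpha> i / t i < p j * (1 - \<alpha> j) ^ (?m j - 1) * \<alpha> j / t j" by blast
  have aj: "0 < \<alpha> j" "\<alpha> j < 1" and tj: "t j > 0"
    using t_pos[OF j] \<alpha>_bounds[OF j] by auto
  define S where "S = (LEAST s. \<xi> s = i)"
  have "\<exists>s. \<xi> s = i"
    using False by (metis (mono_tags, lifting) Collect_empty_eq finite.emptyI)
  then have S: "\<xi> S = i" "\<And>s. s < S \<Longrightarrow> \<xi> s \<noteq> i"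
    unfolding S_def by (auto intro: LeastI_ex dest: not_less_Least)
  have S0: "searches_before \<xi> S i = 0"
    unfolding searches_before_def using S(2) by auto
  \<comment> \<open>With at most \<open>?m j - 1\<close> searches, \<open>j\<close> would still have
    a larger index than \<open>i\<close> at position \<open>S\<close>, where \<open>i\<close> is
    chosen.\<close>
  have "?m j \<le> searches_before \<xi> S j"
  proof (rule ccontr)
    assume "\<not> ?m j \<le> searches_before \<xi> S j"
    then have "p j * (1 - \<alpha> j) ^ (?m j - 1) * \<alpha> j / t j \<le> gittins_index t \<alpha> p \<xi> S j"
      unfolding gittins_index_def using aj tj p[OF j]
      by (intro divide_right_mono mult_right_mono mult_left_mono power_decreasing) auto
    also have "\<dots> \<le> gittins_index t \<alpha> p \<xi> S (\<xi> S)"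
      using \<xi> j by (simp add: gittins_sequences_def gittins_maximal_def)
    also have "\<dots> = p i * \<alpha> i / t i"
      by (simp add: gittins_index_def S(1) S0)
    finally show False
      using ji by simp
  qed
  have "?M / t j < real (?m j)"
    using tj total_time_pos by (simp add: m_const_def) linarith
  then have "?M < real (?m j) * t j"
    using tj by (simp only: pos_divide_less_eq)
  also have "\<dots> \<le> real (searches_before \<xi> S j) * t j"
    using \<open>?m j \<le> _\<close> tj by simp
  also have "\<dots> = (\<Sum>s | s < S \<and> \<xi> s = j. t (\<xi> s))"
    by (simp add: searches_before_def)
  also have "\<dots> \<le> (\<Sum>s<S. t (\<xi> s))"
    using t_pos[OF \<xi>s] by (intro sum_mono2) (auto simp: less_imp_le)
  \<comment> \<open>The search of \<open>i\<close> at \<open>S\<close> itself supplies the excess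
    \<open>t_min\<close>.\<close>
  finally have "?M + t_min \<le> (\<Sum>s\<le>S. t (\<xi> s))"
    using t_min_le[OF \<xi>s, of S] by (simp add: lessThan_Suc_atMost[symmetric])
  also have "ereal \<dots> \<le> u_box t \<alpha> i \<xi>"
    by (rule u_box_ge[OF i \<xi>' S0])
  finally show ?thesis by simp
qed

section \<open>Optimality of Gittins sequences by comparing pairs of searches\<close>

lemma search_at_inj:
  "inj (search_at \<xi>)"
proof (rule linorder_injI)
  fix s s' :: nat assume "s < s'"
  show "search_at \<xi> s \<noteq> search_at \<xi> s'"
  proof
    assume eq: "search_at \<xi> s = search_at \<xi> s'"
    then have "searches_before \<xi> s (\<xi> s) < searches_before \<xi> (Suc s) (\<xi> s)"
      by (simp add: searches_before_Suc)
    also have "\<dots> \<le> searches_before \<xi> s' (\<xi> s)"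
      using \<open>s < s'\<close> by (intro searches_before_mono) simp
    finally show False
      using eq unfolding search_at_def by (metis less_irrefl prod.inject)
  qed
qed

text \<open>Surjectivity uses the infinitely many visits: search \<open>(i, r)\<close> happens at
  position \<open>enumerate {s. \<xi> s = i} r\<close>.\<close>

lemma search_at_bij:
  assumes \<xi>: "\<xi> \<in> search_sequences n"
    and inf: "\<And>i. i \<in> {1..n} \<Longrightarrow> infinite {s. \<xi> s = i}"
  shows "bij_betw (search_at \<xi>) UNIV ({1..n} \<times> UNIV)"
  unfolding bij_betw_def
proof (intro conjI search_at_inj set_eqI iffI)
  fix a assume "a \<in> range (search_at \<xi>)"
  then show "a \<in> {1..n} \<times> UNIV"
    using \<xi> by (auto simp: search_at_def search_sequences_def)
next
  fix a :: "nat \<times> nat" assume "a \<in> {1..n} \<times> UNIV"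
  then have "infinite {s. \<xi> s = fst a}"
    using inf by auto
  then have "search_at \<xi> (enumerate {s. \<xi> s = fst a} (snd a)) = a"
    using enumerate_in_set[of "{s. \<xi> s = fst a}" "snd a"]
    by (simp add: search_at_def searches_before_enumerate)
  then show "a \<in> range (search_at \<xi>)"
    by (metis rangeI)
qed

lemma mass_nonneg:
  assumes "\<And>i. i \<in> {1..n} \<Longrightarrow> 0 \<le> p i" and "fst a \<in> {1..n}"
  shows "0 \<le> mass p a"
  unfolding mass_def using assms \<alpha>_bounds[of "fst a"] by simp

lemma undetected_tendsto_0:
  assumes inf: "\<And>i. i \<in> {1..n} \<Longrightarrow> infinite {s. \<xi> s = i}"
  shows "undetected p \<xi> \<longlonglongrightarrow> 0"
proof -
  have "(\<lambda>s. (1 - \<alpha> i) ^ searches_before \<xi> s i) \<longlonglongrightarrow> 0" if i: "i \<in> {1..n}" for i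
  proof (rule filterlim_compose[where g = "\<lambda>m. (1 - \<alpha> i) ^ m"])
    show "(\<lambda>m. (1 - \<alpha> i) ^ m) \<longlonglongrightarrow> 0"
      using \<alpha>_bounds[OF i] by (intro LIMSEQ_power_zero) simp
    show "filterlim (\<lambda>s. searches_before \<xi> s i) sequentially sequentially"
      unfolding filterlim_at_top eventually_sequentially
      using searches_before_mono searches_before_enumerate[OF inf[OF i]] by metis
  qed
  then have "(\<lambda>s. \<Sum>i=1..n. p i * (1 - \<alpha> i) ^ searches_before \<xi> s i) \<longlonglongrightarrow> (\<Sum>i=1..n. p i * 0)"
    by (intro tendsto_sum tendsto_mult_left)
  then show ?thesis
    by (simp add: undetected_def[abs_def])
qed

text \<open>Telescope \<open>undetected_Suc\<close> from \<open>s\<close> on; no probability is left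
  over, since \<open>undetected\<close> tends to 0.\<close>

lemma undetected_eq_tail:
  assumes p: "\<And>i. i \<in> {1..n} \<Longrightarrow> 0 \<le> p i" and \<xi>: "\<xi> \<in> search_sequences n"
    and inf: "\<And>i. i \<in> {1..n} \<Longrightarrow> infinite {s. \<xi> s = i}"
  shows "ennreal (undetected p \<xi> s) =
    (\<Sum>s'. if s \<le> s' then ennreal (mass p (search_at \<xi> s')) else 0)"
proof -
  let ?d = "\<lambda>s'. mass p (search_at \<xi> s')"
  have d0: "0 \<le> ?d s'" for s'
    using p \<xi> by (intro mass_nonneg) (auto simp: search_at_def search_sequences_def)
  have "(\<lambda>k. undetected p \<xi> (k + s)) \<longlonglongrightarrow> 0"
    using undetected_tendsto_0[OF inf] by (rule LIMSEQ_ignore_initial_segment)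
  then have "(\<lambda>k. undetected p \<xi> (k + s) - undetected p \<xi> (Suc k + s)) sums (undetected p \<xi> (0 + s) - 0)"
    by (rule telescope_sums')
  then have "(\<lambda>k. if s \<le> k + s then ?d (k + s) else 0) sums undetected p \<xi> s"
    by (simp add: undetected_Suc[OF \<xi>])
  then have "(\<lambda>s'. if s \<le> s' then ?d s' else 0) sums undetected p \<xi> s"
    by (subst (asm) sums_zero_iff_shift) auto
  then have "(\<Sum>s'. ennreal (if s \<le> s' then ?d s' else 0)) = ennreal (undetected p \<xi> s)"
    using d0 by (intro suminf_ennreal_eq) auto
  moreover have "ennreal (if s \<le> s' then ?d s' else 0) = (if s \<le> s' then ennreal (?d s') else 0)" for s'
    by simp
  ultimately show ?thesis
    by simp
qed

text \<open>\<open>ordered_pair_cost p \<xi> s s'\<close> is the contribution of the search in position \<open>s\<close> to the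
  completion time of the one in position \<open>s'\<close>. For a pair of distinct searches exactly one of the
  two orders contributes, and \<open>pair_cost\<close> is the cheaper one; in \<open>pair_cost p a a\<close> the contribution
  of \<open>a\<close> to itself is counted twice, as it is in \<open>double_u_mixed\<close> below.\<close>

definition pair_cost :: "(nat \<Rightarrow> real) \<Rightarrow> nat \<times> nat \<Rightarrow> nat \<times> nat \<Rightarrow> ennreal" where
  "pair_cost p a b =
     ennreal (min (t (fst a) * mass p b) (t (fst b) * mass p a)) +
     (if a = b then ennreal (t (fst a) * mass p a) else 0)"

definition ordered_pair_cost :: "(nat \<Rightarrow> real) \<Rightarrow> (nat \<Rightarrow> nat) \<Rightarrow> nat \<Rightarrow> nat \<Rightarrow> ennreal" where
  "ordered_pair_cost p \<xi> s s' =
     (if s \<le> s' then ennreal (t (\<xi> s) * mass p (search_at \<xi> s')) else 0)"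

text \<open>By \<open>undetected_eq_tail\<close>, the cost is the sum of
  \<open>ordered_pair_cost\<close> over all ordered pairs. Adding the transposed sum makes the
  summand symmetric, hence comparable with \<open>pair_cost\<close>, which ignores the
  order.\<close>

lemma double_u_mixed:
  assumes p: "\<And>i. i \<in> {1..n} \<Longrightarrow> 0 \<le> p i" and \<xi>: "\<xi> \<in> search_sequences n"
    and inf: "\<And>i. i \<in> {1..n} \<Longrightarrow> infinite {s. \<xi> s = i}"
  shows "2 * u_mixed n t \<alpha> p \<xi> =
    enn2ereal (\<Sum>s. \<Sum>s'. ordered_pair_cost p \<xi> s s' + ordered_pair_cost p \<xi> s' s)"
proof -
  have t0: "0 \<le> t (\<xi> s)" for s
    using t_pos[of "\<xi> s"] \<xi> by (simp add: search_sequences_def less_imp_le)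
  let ?c = "ordered_pair_cost p \<xi>"
  have "ennreal (t (\<xi> s) * undetected p \<xi> s) = (\<Sum>s'. ?c s s')" for s
  proof -
    have "ennreal (t (\<xi> s) * undetected p \<xi> s) =
        ennreal (t (\<xi> s)) * (\<Sum>s'. if s \<le> s' then ennreal (mass p (search_at \<xi> s')) else 0)"
      using undetected_eq_tail[where p = p, OF _ \<xi> inf] p t0 by (simp add: ennreal_mult')
    also have "\<dots> = (\<Sum>s'. ?c s s')"
      using t0 by (subst ennreal_suminf_cmult[symmetric], intro suminf_cong)
        (simp add: ordered_pair_cost_def ennreal_mult' del: ennreal_suminf_cmult)
    finally show ?thesis .
  qed
  moreover have "u_mixed n t \<alpha> p \<xi> = enn2ereal (\<Sum>s. ennreal (t (\<xi> s) * undetected p \<xi> s))"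
    by (rule u_mixed_eq) (use p \<xi> in auto)
  ultimately have u: "u_mixed n t \<alpha> p \<xi> = enn2ereal (\<Sum>s. \<Sum>s'. ?c s s')"
    by simp
  have "2 * (\<Sum>s. \<Sum>s'. ?c s s') = (\<Sum>s. \<Sum>s'. ?c s s') + (\<Sum>s. \<Sum>s'. ?c s' s)"
    by (simp add: mult_2 suminf_swap_ennreal[of "\<lambda>s s'. ?c s' s"])
  also have "\<dots> = (\<Sum>s. \<Sum>s'. ?c s s' + ?c s' s)"
    by (simp add: suminf_add[symmetric] summableI)
  finally show ?thesis
    unfolding u by (metis enn2ereal_numeral times_ennreal.rep_eq)
qed

text \<open>Reindexing along \<open>search_at_bij\<close> removes \<xi> from the right-hand side, so
  the total is the same for all such sequences.\<close>

lemma suminf_pair_cost_eq: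
  assumes \<xi>: "\<xi> \<in> search_sequences n"
    and inf: "\<And>i. i \<in> {1..n} \<Longrightarrow> infinite {s. \<xi> s = i}"
  shows "(\<Sum>s. \<Sum>s'. pair_cost p (search_at \<xi> s) (search_at \<xi> s')) =
    (\<integral>\<^sup>+a. \<integral>\<^sup>+b. pair_cost p a b \<partial>count_space ({1..n} \<times> UNIV) \<partial>count_space ({1..n} \<times> UNIV))"
proof -
  let ?J = "count_space ({1..n} \<times> (UNIV :: nat set))"
  note bij = search_at_bij[OF \<xi> inf]
  have "(\<Sum>s'. pair_cost p a (search_at \<xi> s')) = (\<integral>\<^sup>+b. pair_cost p a b \<partial>?J)" for a
    unfolding nn_integral_count_space_nat[symmetric]
    by (rule nn_integral_bij_count_space[OF bij])
  then have "(\<Sum>s. \<Sum>s'. pair_cost p (search_at \<xi> s) (search_at \<xi> s')) =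
      (\<Sum>s. \<integral>\<^sup>+b. pair_cost p (search_at \<xi> s) b \<partial>?J)"
    by simp
  also have "\<dots> = (\<integral>\<^sup>+a. \<integral>\<^sup>+b. pair_cost p a b \<partial>?J \<partial>?J)"
    unfolding nn_integral_count_space_nat[symmetric]
    by (rule nn_integral_bij_count_space[OF bij])
  finally show ?thesis .
qed

text \<open>Off the diagonal one ordered cost is 0 and the other is an argument of the minimum; on
  the diagonal both sides count the cost twice.\<close>

lemma pair_cost_le:
  assumes p: "\<And>i. i \<in> {1..n} \<Longrightarrow> 0 \<le> p i" and \<xi>: "\<xi> \<in> search_sequences n"
  shows "pair_cost p (search_at \<xi> s) (search_at \<xi> s') \<le>
    ordered_pair_cost p \<xi> s s' + ordered_pair_cost p \<xi> s' s"
proof -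
  have "search_at \<xi> s = search_at \<xi> s' \<longleftrightarrow> s = s'"
    using search_at_inj by (simp add: inj_eq)
  moreover have "fst (search_at \<xi> s) = \<xi> s" for s
    by (simp add: search_at_def)
  ultimately show ?thesis
    by (cases s s' rule: linorder_cases)
       (auto simp: pair_cost_def ordered_pair_cost_def intro!: ennreal_leI)
qed

text \<open>\<open>mass\<close> over search time is the index of the searched box. The index of
  \<open>\<xi> s'\<close> can only fall between \<open>s\<close> and \<open>s'\<close>, and at
  \<open>s\<close> it is at most that of the chosen box. The cross-multiplied form matches the
  minimum in \<open>pair_cost\<close>.\<close>

lemma gittins_ratio_antimono:
  assumes p: "\<And>i. i \<in> {1..n} \<Longrightarrow> 0 \<le> p i" and \<xi>: "\<xi> \<in> gittins_sequences n t \<alpha> p" and "s \<le> s'"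
  shows "t (\<xi> s) * mass p (search_at \<xi> s') \<le> t (\<xi> s') * mass p (search_at \<xi> s)"
proof -
  let ?g = "gittins_index t \<alpha> p \<xi>"
  have \<xi>s: "\<xi> s \<in> {1..n}" for s
    using \<xi> gittins_sequences_subset by (auto simp: search_sequences_def)
  have mass: "mass p (search_at \<xi> s) = ?g s (\<xi> s) * t (\<xi> s)" for s
    using t_pos[OF \<xi>s, of s] by (simp add: mass_def search_at_def gittins_index_def)
  have "?g s' (\<xi> s') \<le> ?g s (\<xi> s')"
    unfolding gittins_index_def
    using p[OF \<xi>s] \<alpha>_bounds[OF \<xi>s, of s'] t_pos[OF \<xi>s, of s'] \<open>s \<le> s'\<close>
    by (intro divide_right_mono mult_right_mono mult_left_mono power_decreasing searches_before_mono) auto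
  also have "\<dots> \<le> ?g s (\<xi> s)"
    using \<xi> \<xi>s by (simp add: gittins_sequences_def gittins_maximal_def)
  finally have "t (\<xi> s) * t (\<xi> s') * ?g s' (\<xi> s') \<le> t (\<xi> s) * t (\<xi> s') * ?g s (\<xi> s)"
    using t_pos[OF \<xi>s] by (intro mult_left_mono) (auto simp: less_imp_le)
  then show ?thesis
    by (simp add: mass mult_ac)
qed

lemma pair_cost_gittins:
  assumes p: "\<And>i. i \<in> {1..n} \<Longrightarrow> 0 \<le> p i" and \<xi>: "\<xi> \<in> gittins_sequences n t \<alpha> p"
  shows "pair_cost p (search_at \<xi> s) (search_at \<xi> s') =
    ordered_pair_cost p \<xi> s s' + ordered_pair_cost p \<xi> s' s"
proof -
  have "search_at \<xi> s = search_at \<xi> s' \<longleftrightarrow> s = s'"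
    using search_at_inj by (simp add: inj_eq)
  moreover have "fst (search_at \<xi> s) = \<xi> s" for s
    by (simp add: search_at_def)
  ultimately show ?thesis
    using gittins_ratio_antimono[where p = p, OF _ \<xi>, of s s'] gittins_ratio_antimono[where p = p, OF _ \<xi>, of s' s] p
    by (cases s s' rule: linorder_cases)
       (auto simp: pair_cost_def ordered_pair_cost_def min_absorb1 min_absorb2)
qed

lemma mult_u_box_le_u_mixed:
  assumes p: "\<And>i. i \<in> {1..n} \<Longrightarrow> 0 \<le> p i" and \<xi>: "\<xi> \<in> search_sequences n"
    and i: "i \<in> {1..n}"
  shows "ereal (p i) * u_box t \<alpha> i \<xi> \<le> u_mixed n t \<alpha> p \<xi>"
proof -
  have "(\<Sum>j\<in>{i}. ereal (p j) * u_box t \<alpha> j \<xi>) \<le> u_mixed n t \<alpha> p \<xi>"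
    unfolding u_mixed_def using i p u_box_nonneg[OF _ \<xi>]
    by (intro sum_mono2) auto
  then show ?thesis
    by simp
qed

lemma infinite_if_u_mixed_finite:
  assumes p: "\<And>i. i \<in> {1..n} \<Longrightarrow> 0 < p i" and \<xi>: "\<xi> \<in> search_sequences n"
    and fin: "u_mixed n t \<alpha> p \<xi> < \<infinity>" and i: "i \<in> {1..n}"
  shows "infinite {s. \<xi> s = i}"
proof
  assume "finite {s. \<xi> s = i}"
  then have "ereal (p i) * u_box t \<alpha> i \<xi> = \<infinity>"
    using p[OF i] by (simp add: u_box_def)
  moreover have "ereal (p i) * u_box t \<alpha> i \<xi> \<le> u_mixed n t \<alpha> p \<xi>"
    using i p by (intro mult_u_box_le_u_mixed \<xi>) (auto simp: less_imp_le)
  ultimately show False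
    using fin by (metis leD)
qed

text \<open>Smith's rule from scheduling: the expected time is the sum, over all ordered pairs of
  searches, of the duration of the first times the detection probability of the second. Every
  sequence visiting all boxes infinitely often performs the same searches \<open>(i, r)\<close>, and the
  Gittins sequence puts each pair of them in its cheaper order.\<close>

lemma gittins_optimal:
  assumes p: "\<And>i. i \<in> {1..n} \<Longrightarrow> 0 < p i" and sum: "(\<Sum>i=1..n. p i) = 1"
    and \<xi>: "\<xi> \<in> gittins_sequences n t \<alpha> p" and \<zeta>: "\<zeta> \<in> search_sequences n"
  shows "u_mixed n t \<alpha> p \<xi> \<le> u_mixed n t \<alpha> p \<zeta>"
proof (cases "u_mixed n t \<alpha> p \<zeta> < \<infinity>")
  case True
  have p': "\<And>i. i \<in> {1..n} \<Longrightarrow> 0 \<le> p i"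
    using p by (auto simp: less_imp_le)
  have \<xi>': "\<xi> \<in> search_sequences n"
    using \<xi> gittins_sequences_subset by blast
  have "u_mixed n t \<alpha> p \<xi> \<le> ereal (total_time n t \<alpha>)"
    using gittins_u_mixed_le[where p = p, OF _ sum \<xi>] p' by blast
  then have "u_mixed n t \<alpha> p \<xi> < \<infinity>"
    by auto
  then have inf_\<xi>: "\<And>i. i \<in> {1..n} \<Longrightarrow> infinite {s. \<xi> s = i}"
    using infinite_if_u_mixed_finite[where p = p, OF _ \<xi>'] p by blast
  \<comment> \<open>As all \<open>p i\<close> are positive, finite cost forces infinitely many
    visits to every box.\<close>
  have inf_\<zeta>: "\<And>i. i \<in> {1..n} \<Longrightarrow> infinite {s. \<zeta> s = i}"
    using infinite_if_u_mixed_finite[where p = p, OF _ \<zeta> True] p by blast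
  have "(\<Sum>s. \<Sum>s'. ordered_pair_cost p \<xi> s s' + ordered_pair_cost p \<xi> s' s) =
      (\<Sum>s. \<Sum>s'. pair_cost p (search_at \<xi> s) (search_at \<xi> s'))"
    using pair_cost_gittins[where p = p, OF _ \<xi>] p' by simp
  also have "\<dots> = (\<Sum>s. \<Sum>s'. pair_cost p (search_at \<zeta> s) (search_at \<zeta> s'))"
    using suminf_pair_cost_eq[OF \<xi>' inf_\<xi>] suminf_pair_cost_eq[OF \<zeta> inf_\<zeta>] by simp
  also have "\<dots> \<le> (\<Sum>s. \<Sum>s'. ordered_pair_cost p \<zeta> s s' + ordered_pair_cost p \<zeta> s' s)"
    using pair_cost_le[where p = p, OF _ \<zeta>] p' by (intro suminf_le summableI) blast
  finally have "2 * u_mixed n t \<alpha> p \<xi> \<le> 2 * u_mixed n t \<alpha> p \<zeta>"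
    using double_u_mixed[where p = p, OF _ \<xi>' inf_\<xi>] double_u_mixed[where p = p, OF _ \<zeta> inf_\<zeta>] p'
    by (simp add: less_eq_ennreal.rep_eq)
  then show ?thesis
    by (simp add: ereal_mult_le_mult_iff)
qed auto

lemma u_opt_eq_gittins:
  assumes p: "\<And>i. i \<in> {1..n} \<Longrightarrow> 0 < p i" and sum: "(\<Sum>i=1..n. p i) = 1"
    and \<xi>: "\<xi> \<in> gittins_sequences n t \<alpha> p"
  shows "u_opt n t \<alpha> p = u_mixed n t \<alpha> p \<xi>"
  unfolding u_opt_def
proof (rule antisym)
  show "(INF \<xi>\<in>search_sequences n. u_mixed n t \<alpha> p \<xi>) \<le> u_mixed n t \<alpha> p \<xi>"
    by (rule INF_lower) (use \<xi> gittins_sequences_subset in blast)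
  show "u_mixed n t \<alpha> p \<xi> \<le> (INF \<xi>\<in>search_sequences n. u_mixed n t \<alpha> p \<xi>)"
    by (rule INF_greatest, rule gittins_optimal[where p = p]) (use p sum \<xi> in auto)
qed

section \<open>The gap in the linear program at a binding constraint\<close>

lemma u_mixed_real:
  assumes "\<And>i. i \<in> {1..n} \<Longrightarrow> u_box t \<alpha> i \<xi> = ereal (x i)"
  shows "u_mixed n t \<alpha> p \<xi> = ereal (\<Sum>i=1..n. p i * x i)"
  unfolding u_mixed_def using assms by simp

text \<open>Taking \<delta> for \<open>d\<close> gives bounds common to all iterations; taking
  \<open>p\<close> itself gives finiteness.\<close>

lemma gittins_u_box_bounded:
  assumes d: "\<And>i. i \<in> {1..n} \<Longrightarrow> 0 < d i" and pd: "\<And>i. i \<in> {1..n} \<Longrightarrow> d i \<le> p i"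
    and sum: "(\<Sum>i=1..n. p i) = 1" and \<xi>: "\<xi> \<in> gittins_sequences n t \<alpha> p"
  shows "\<exists>x. \<forall>i\<in>{1..n}. u_box t \<alpha> i \<xi> = ereal (x i) \<and> 0 \<le> x i \<and> x i \<le> total_time n t \<alpha> / d i"
proof -
  have p: "0 \<le> p i" if "i \<in> {1..n}" for i
    using d[OF that] pd[OF that] by simp
  have \<xi>': "\<xi> \<in> search_sequences n"
    using \<xi> gittins_sequences_subset by blast
  have "\<exists>y. u_box t \<alpha> i \<xi> = ereal y \<and> 0 \<le> y \<and> y \<le> total_time n t \<alpha> / d i" if i: "i \<in> {1..n}" for i
  proof -
    have "ereal (d i) * u_box t \<alpha> i \<xi> \<le> ereal (p i) * u_box t \<alpha> i \<xi>"
      using pd[OF i] u_box_nonneg[OF i \<xi>'] by (intro ereal_mult_right_mono) auto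
    also have "\<dots> \<le> u_mixed n t \<alpha> p \<xi>"
      using p by (intro mult_u_box_le_u_mixed \<xi>' i) auto
    also have "\<dots> \<le> ereal (total_time n t \<alpha>)"
      using p by (intro gittins_u_mixed_le sum \<xi>) auto
    finally have le: "ereal (d i) * u_box t \<alpha> i \<xi> \<le> ereal (total_time n t \<alpha>)" .
    then show ?thesis
      using d[OF i] u_box_nonneg[OF i \<xi>']
      by (cases "u_box t \<alpha> i \<xi>") (auto simp: pos_le_divide_eq mult.commute)
  qed
  then show ?thesis
    by (intro bchoice) blast
qed

text \<open>If some boxes have probability close to their lower bound, moving mass to all of them at
  once, proportionally to \<open>\<delta>\<close>, stays feasible. By \<open>gittins_late_search\<close> it also raises the
  value of the game by an amount that does not depend on \<open>p\<close>.\<close>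

lemma lp_gap_if_binding:
  assumes \<delta>: "\<And>i. i \<in> {1..n} \<Longrightarrow> 0 < \<delta> i \<and> \<delta> i < eta n t \<alpha> i"
  obtains \<gamma> where "\<gamma> > 0"
    "\<And>D p v i. D \<subseteq> search_sequences n \<Longrightarrow> lp_optimal n t \<alpha> \<delta> D p v \<Longrightarrow> i \<in> {1..n} \<Longrightarrow>
       p i \<le> \<delta> i \<Longrightarrow> u_opt n t \<alpha> p + ereal \<gamma> \<le> ereal v"
proof -
  define \<theta> where "\<theta> = (\<lambda>i. (\<delta> i + eta n t \<alpha> i) / 2)"
  have \<theta>: "\<delta> i < \<theta> i" "\<theta> i < eta n t \<alpha> i" "0 < \<theta> i" if "i \<in> {1..n}" for i
    using \<delta>[OF that] by (auto simp: \<theta>_def)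
  \<comment> \<open>\<open>s\<close> will be the fraction of mass moved. The first bound keeps a box
    above \<theta> from falling below \<delta> when it loses this fraction; the second keeps a box
    at or below \<theta> below \<open>eta\<close> when it gains at most \<open>s\<close>.\<close>
  have "\<exists>s>0. \<forall>i\<in>{1..n}. s < min (1 - \<delta> i / \<theta> i) (eta n t \<alpha> i - \<theta> i)"
    using \<theta> by (intro finite_pos_lower_bound) auto
  then obtain s where "s > 0" and s: "\<And>i. i \<in> {1..n} \<Longrightarrow> s < 1 - \<delta> i / \<theta> i"
      "\<And>i. i \<in> {1..n} \<Longrightarrow> s < eta n t \<alpha> i - \<theta> i"
    by auto
  have "s < 1"
  proof -
    have 1: "1 \<in> {1..n}"
      using n_pos by simp
    have "0 < \<delta> 1 / \<theta> 1"
      using \<delta>[OF 1] \<theta>(3)[OF 1] by (intro divide_pos_pos) auto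
    then show ?thesis
      using s(1)[OF 1] by simp
  qed
  let ?M = "total_time n t \<alpha>"
  show thesis
  proof
    show "s * t_min > 0"
      using \<open>s > 0\<close> t_min_pos by simp
  next
    fix D p v i0
    assume D: "D \<subseteq> search_sequences n" and opt: "lp_optimal n t \<alpha> \<delta> D p v"
      and i0: "i0 \<in> {1..n}" "p i0 \<le> \<delta> i0"
    have p: "\<And>i. i \<in> {1..n} \<Longrightarrow> \<delta> i \<le> p i" and sum_p: "(\<Sum>i=1..n. p i) = 1"
      using opt by (auto simp: lp_optimal_def lp_feasible_def)
    have p_pos: "0 < p i" if "i \<in> {1..n}" for i
      using p[OF that] \<delta>[OF that] by simp
    define B where "B = {i \<in> {1..n}. p i \<le> \<theta> i}"
    have B: "B \<subseteq> {1..n}" "finite B" "i0 \<in> B"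
      using i0 \<theta>[OF i0(1)] by (auto simp: B_def)
    define b where "b = (\<Sum>i\<in>B. \<delta> i)"
    have "b > 0"
      unfolding b_def using B \<delta> by (intro sum_pos) auto
    have "b \<le> (\<Sum>i\<in>B. p i)"
      unfolding b_def using B p by (intro sum_mono) auto
    also have "\<dots> \<le> (\<Sum>i=1..n. p i)"
      using B p_pos by (intro sum_mono2) (auto simp: less_imp_le)
    finally have "b \<le> 1"
      using sum_p by simp
    \<comment> \<open>The weights \<delta> normalised on \<open>B\<close>, which contains
      \<open>i0\<close>. As \<open>b \<le> 1\<close>, \<open>q\<close> is at least \<delta> there,
      so boxes in \<open>B\<close> stay feasible after mixing.\<close>
    define q where "q = (\<lambda>i. if i \<in> B then \<delta> i / b else 0)"
    have q0: "\<And>i. i \<in> {1..n} \<Longrightarrow> 0 \<le> q i"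
      using \<delta> \<open>b > 0\<close> by (auto simp: q_def less_imp_le)
    have q_ge: "\<delta> i \<le> q i" and q_le: "q i \<le> 1" if i: "i \<in> B" for i
    proof -
      have "i \<in> {1..n}" using i B by auto
      then have "\<delta> i > 0" using \<delta> by auto
      then show "\<delta> i \<le> q i"
        using i \<open>b > 0\<close> \<open>b \<le> 1\<close> by (simp add: q_def pos_le_divide_eq mult_le_cancel_left1)
      have "\<delta> i \<le> b"
        unfolding b_def using B i \<delta> by (intro member_le_sum) (auto simp: less_imp_le)
      then show "q i \<le> 1"
        using i \<open>b > 0\<close> by (simp add: q_def)
    qed
    have sum_q: "(\<Sum>i=1..n. q i) = 1"
    proof -
      have "(\<Sum>i=1..n. q i) = (\<Sum>i\<in>B. \<delta> i / b)"
        unfolding q_def using B by (subst sum.inter_restrict[symmetric]) (auto simp: Int_absorb1)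
      also have "\<dots> = 1"
        using \<open>b > 0\<close> by (simp add: b_def flip: sum_divide_distrib)
      finally show ?thesis .
    qed
    define r where "r = (\<lambda>i. (1 - s) * p i + s * q i)"
    have r_ge: "\<delta> i \<le> r i" if i: "i \<in> {1..n}" for i
    proof (cases "i \<in> B")
      case True
      have "(1 - s) * \<delta> i + s * \<delta> i \<le> r i"
        unfolding r_def using p[OF i] q_ge[OF True] \<open>s > 0\<close> \<open>s < 1\<close>
        by (intro add_mono mult_left_mono) auto
      then show ?thesis
        by (simp add: algebra_simps)
    next
      case False
      have "\<delta> i / \<theta> i \<le> 1 - s"
        using s(1)[OF i] by simp
      then have "\<delta> i \<le> (1 - s) * \<theta> i"
        using \<theta>(3)[OF i] by (simp add: pos_divide_le_eq)
      also have "\<dots> \<le> (1 - s) * p i"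
        using False i \<open>s < 1\<close> by (intro mult_left_mono) (auto simp: B_def)
      also have "\<dots> \<le> r i"
        using q0[OF i] \<open>s > 0\<close> by (simp add: r_def)
      finally show ?thesis .
    qed
    have r_pos: "0 < r i" if "i \<in> {1..n}" for i
      using r_ge[OF that] \<delta>[OF that] by simp
    have sum_r: "(\<Sum>i=1..n. r i) = 1"
      unfolding r_def sum.distrib sum_distrib_left[symmetric] sum_p sum_q by simp
    have r_less: "r i < eta n t \<alpha> i" if i: "i \<in> B" for i
    proof -
      have i': "i \<in> {1..n}" using i B by auto
      have "r i \<le> (1 - s) * \<theta> i + s * 1"
        unfolding r_def using i q_le[OF i] \<open>s > 0\<close> \<open>s < 1\<close>
        by (intro add_mono mult_left_mono) (auto simp: B_def)
      also have "\<dots> \<le> \<theta> i + s"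
        using \<theta>(3)[OF i'] \<open>s > 0\<close> by (simp add: algebra_simps)
      also have "\<dots> < eta n t \<alpha> i"
        using s(2)[OF i'] by simp
      finally show ?thesis .
    qed
    obtain \<zeta> where \<zeta>: "\<zeta> \<in> gittins_sequences n t \<alpha> r"
      using ex_gittins by blast
    have \<zeta>': "\<zeta> \<in> search_sequences n"
      using \<zeta> gittins_sequences_subset by blast
    have "\<exists>x. \<forall>i\<in>{1..n}. u_box t \<alpha> i \<zeta> = ereal (x i) \<and> 0 \<le> x i \<and> x i \<le> ?M / r i"
      by (rule gittins_u_box_bounded) (use r_pos sum_r \<zeta> in auto)
    then obtain x where x: "\<And>i. i \<in> {1..n} \<Longrightarrow> u_box t \<alpha> i \<zeta> = ereal (x i)"
      by blast
    have ux: "u_mixed n t \<alpha> p' \<zeta> = ereal (\<Sum>i=1..n. p' i * x i)" for p'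
      by (rule u_mixed_real) (rule x)
    \<comment> \<open>\<open>q\<close> lives on \<open>B\<close>, where \<open>r\<close> is below
      \<open>eta\<close>; a Gittins sequence against \<open>r\<close> searches these boxes
      late.\<close>
    have "ereal (?M + t_min) \<le> u_mixed n t \<alpha> q \<zeta>"
    proof (rule u_mixed_ge[OF q0 sum_q])
      fix i assume i: "i \<in> {1..n}" "0 < q i"
      then have "i \<in> B"
        by (auto simp: q_def split: if_splits)
      then show "ereal (?M + t_min) \<le> u_box t \<alpha> i \<zeta>"
        using r_pos i r_less by (intro gittins_late_search[where p = r] sum_r \<zeta>) (auto simp: less_imp_le)
    qed
    then have uq: "?M + t_min \<le> (\<Sum>i=1..n. q i * x i)"
      by (simp add: ux)
    obtain \<xi> where \<xi>: "\<xi> \<in> gittins_sequences n t \<alpha> p"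
      using ex_gittins by blast
    have "\<exists>y. \<forall>i\<in>{1..n}. u_box t \<alpha> i \<xi> = ereal (y i) \<and> 0 \<le> y i \<and> y i \<le> ?M / p i"
      by (rule gittins_u_box_bounded) (use p_pos sum_p \<xi> in auto)
    then obtain y where y: "\<And>i. i \<in> {1..n} \<Longrightarrow> u_box t \<alpha> i \<xi> = ereal (y i)"
      by blast
    define L where "L = (\<Sum>i=1..n. p i * y i)"
    have L: "u_mixed n t \<alpha> p \<xi> = ereal L"
      unfolding L_def by (rule u_mixed_real) (rule y)
    have L_le: "L \<le> ?M"
      using gittins_u_mixed_le[where p = p, OF _ sum_p \<xi>] p_pos by (auto simp: L less_imp_le)
    have up: "L \<le> (\<Sum>i=1..n. p i * x i)"
      using gittins_optimal[where p = p, OF p_pos sum_p \<xi> \<zeta>'] by (simp add: L ux)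
    \<comment> \<open>\<open>L \<le> ?M\<close>, so the mass moved gains at least
      \<open>t_min\<close> over the average \<open>L\<close>.\<close>
    have "L + s * t_min \<le> (1 - s) * L + s * (?M + t_min)"
      using mult_left_mono[OF L_le, of s] \<open>s > 0\<close> by (simp add: algebra_simps)
    also have "\<dots> \<le> (1 - s) * (\<Sum>i=1..n. p i * x i) + s * (\<Sum>i=1..n. q i * x i)"
      using up uq \<open>s > 0\<close> \<open>s < 1\<close> by (intro add_mono mult_left_mono) auto
    also have "\<dots> = (\<Sum>i=1..n. r i * x i)"
      by (simp add: r_def distrib_right sum.distrib sum_distrib_left mult.assoc)
    also have "\<dots> \<le> v"
    proof -
      \<comment> \<open>\<zeta> is a best response to \<open>r\<close>, so its cost is at most that
        of every sequence in \<open>D\<close> and is an admissible LP value.\<close>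
      have "lp_feasible n t \<alpha> \<delta> D r (\<Sum>i=1..n. r i * x i)"
        unfolding lp_feasible_def ux[symmetric]
        using gittins_optimal[where p = r, OF r_pos sum_r \<zeta>] D r_ge sum_r by auto
      then show ?thesis
        using opt by (simp add: lp_optimal_def)
    qed
    finally show "u_opt n t \<alpha> p + ereal (s * t_min) \<le> ereal v"
      using u_opt_eq_gittins[where p = p, OF p_pos sum_p \<xi>] by (simp add: L)
  qed
qed

section \<open>Termination of the algorithm\<close>

lemma initial_sequences_subset: "initial_sequences n t \<alpha> \<subseteq> search_sequences n"
proof
  fix \<xi> assume "\<xi> \<in> initial_sequences n t \<alpha>"
  then obtain k where
    "find (gittins_maximal n t \<alpha> (p_init n t \<alpha>) \<xi> s) (rotate k [1..<Suc n]) = Some (\<xi> s)" for s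
    unfolding initial_sequences_def gittins_with_ties_def by blast
  then have "gittins_maximal n t \<alpha> (p_init n t \<alpha>) \<xi> s (\<xi> s)" for s
    by (metis find_Some_iff)
  then show "\<xi> \<in> search_sequences n"
    by (simp add: gittins_maximal_def search_sequences_def)
qed

text \<open>The value 0 is feasible together with the same \<open>p\<close>.\<close>

lemma lp_optimal_nonneg:
  assumes \<delta>: "\<And>i. i \<in> {1..n} \<Longrightarrow> 0 < \<delta> i" and D: "D \<subseteq> search_sequences n"
    and opt: "lp_optimal n t \<alpha> \<delta> D p v"
  shows "0 \<le> v"
proof -
  have p: "0 \<le> p i" if "i \<in> {1..n}" for i
  proof -
    have "\<delta> i \<le> p i"
      using opt that unfolding lp_optimal_def lp_feasible_def by blast
    then show ?thesis
      using \<delta>[OF that] by simp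
  qed
  have "0 \<le> u_mixed n t \<alpha> p \<xi>" if "\<xi> \<in> D" for \<xi>
    unfolding u_mixed_def
  proof (rule sum_nonneg)
    fix i assume i: "i \<in> {1..n}"
    have "\<xi> \<in> search_sequences n"
      using D that by blast
    then show "0 \<le> ereal (p i) * u_box t \<alpha> i \<xi>"
      using p[OF i] u_box_nonneg[OF i] by simp
  qed
  then have "lp_feasible n t \<alpha> \<delta> D p 0"
    using opt by (simp add: lp_optimal_def lp_feasible_def zero_ereal_def)
  then show ?thesis
    using opt by (simp add: lp_optimal_def)
qed

lemma u_opt_ge_t_min:
  assumes "\<And>i. i \<in> {1..n} \<Longrightarrow> 0 \<le> p i" and "(\<Sum>i=1..n. p i) = 1"
  shows "ereal t_min \<le> u_opt n t \<alpha> p"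
  unfolding u_opt_def
  by (rule INF_greatest, rule u_mixed_ge) (use assms u_box_ge_t_min in auto)

lemma algorithm_terminates:
  assumes \<delta>: "\<And>i. i \<in> {1..n} \<Longrightarrow> 0 < \<delta> i \<and> \<delta> i < eta n t \<alpha> i"
    and "\<epsilon> > 0" and run: "algorithm_run n t \<alpha> \<delta> \<epsilon> D p v \<xi>"
  shows "\<exists>k\<ge>1. stops n t \<alpha> \<delta> \<epsilon> (p k) (v k)"
proof (rule ccontr)
  assume "\<not> ?thesis"
  then have nostop: "\<not> stops n t \<alpha> \<delta> \<epsilon> (p k) (v k)" if "k \<ge> 1" for k
    using that by blast
  have opt: "lp_optimal n t \<alpha> \<delta> (D k) (p k) (v k)"
    and \<xi>: "\<xi> k \<in> gittins_sequences n t \<alpha> (p k)"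
    and D_Suc: "D (Suc k) = D k \<union> {\<xi> k}" if "k \<ge> 1" for k
    using run nostop that by (auto simp: algorithm_run_def)
  have D: "D k \<subseteq> search_sequences n" if "k \<ge> 1" for k
    using that
  proof (induction k rule: dec_induct)
    case base
    then show ?case
      using run initial_sequences_subset by (simp add: algorithm_run_def)
  next
    case (step k)
    then show ?case
      using D_Suc[of k] \<xi>[of k] gittins_sequences_subset by auto
  qed
  have \<xi>_in_D: "\<xi> k \<in> D k'" if "1 \<le> k" "k < k'" for k k'
    using Suc_leI[OF \<open>k < k'\<close>]
  proof (induction k' rule: dec_induct)
    case base
    then show ?case
      using D_Suc[of k] that by simp
  next
    case (step m)
    then show ?case
      using D_Suc[of m] that by simp
  qed
  have p: "\<delta> i \<le> p k i" "0 < p k i" if "k \<ge> 1" "i \<in> {1..n}" for k i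
  proof -
    show "\<delta> i \<le> p k i"
      using opt[OF that(1)] that(2) unfolding lp_optimal_def lp_feasible_def by blast
    then show "0 < p k i"
      using \<delta>[OF that(2)] by simp
  qed
  have sum_p: "(\<Sum>i=1..n. p k i) = 1" if "k \<ge> 1" for k
    using opt[OF that] by (simp add: lp_optimal_def lp_feasible_def)
  have p_le: "p k i \<le> 1" if "k \<ge> 1" "i \<in> {1..n}" for k i
    using member_le_sum[of i "{1..n}" "p k"] p(2)[OF that(1)] sum_p[OF that(1)] that(2)
    by (auto simp: less_imp_le)
  let ?M = "total_time n t \<alpha>"
  \<comment> \<open>\<open>C\<close> bounds all coordinates used below and is also the error factor:
    if two iterations agree up to \<open>h\<close>, the 1 accounts for the change in
    \<open>v\<close> and the sum for the change in \<open>p\<close>.\<close>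
  define C where "C = 1 + (\<Sum>i=1..n. ?M / \<delta> i)"
  have M\<delta>: "0 \<le> ?M / \<delta> i" if "i \<in> {1..n}" for i
    using \<delta>[OF that] total_time_pos by simp
  have "C \<ge> 1"
  proof -
    have "0 \<le> (\<Sum>i=1..n. ?M / \<delta> i)"
      by (rule sum_nonneg) (rule M\<delta>)
    then show ?thesis
      by (simp add: C_def)
  qed
  obtain y where y: "\<And>k i. k \<ge> 1 \<Longrightarrow> i \<in> {1..n} \<Longrightarrow> u_box t \<alpha> i (\<xi> k) = ereal (y k i)"
    "\<And>k i. k \<ge> 1 \<Longrightarrow> i \<in> {1..n} \<Longrightarrow> 0 \<le> y k i"
    "\<And>k i. k \<ge> 1 \<Longrightarrow> i \<in> {1..n} \<Longrightarrow> y k i \<le> ?M / \<delta> i"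
  proof -
    have "\<exists>y. \<forall>i\<in>{1..n}. u_box t \<alpha> i (\<xi> k) = ereal (y i) \<and> 0 \<le> y i \<and> y i \<le> ?M / \<delta> i"
      if k: "k \<ge> 1" for k
      by (rule gittins_u_box_bounded[where p = "p k"]) (use \<delta> p(1)[OF k] sum_p[OF k] \<xi>[OF k] in auto)
    then show thesis
      using that by metis
  qed
  have v_le: "v k' \<le> (\<Sum>i=1..n. p k' i * y k i)" if "1 \<le> k" "k < k'" for k k'
    using opt[of k'] \<xi>_in_D[OF that] u_mixed_real[OF y(1)[OF that(1)], of "p k'"] that
    by (auto simp: lp_optimal_def lp_feasible_def)
  \<comment> \<open>From iteration 2 on, the constraint contributed by \<open>\<xi> 1\<close> bounds
    the LP value.\<close>
  have v_bound: "0 \<le> v k" "v k \<le> C" if k: "k \<ge> 2" for k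
  proof -
    show "0 \<le> v k"
      using lp_optimal_nonneg[of \<delta>, OF _ D opt] \<delta> k by auto
    have "v k \<le> (\<Sum>i=1..n. p k i * y 1 i)"
      using v_le[of 1 k] k by simp
    also have "\<dots> \<le> (\<Sum>i=1..n. 1 * (?M / \<delta> i))"
      using p(2)[of k] p_le[of k] y(2,3)[of 1] k by (intro sum_mono mult_mono) (auto simp: less_imp_le)
    finally show "v k \<le> C"
      by (simp add: C_def)
  qed
  obtain \<gamma> where "\<gamma> > 0" and \<gamma>: "\<And>D p v i. D \<subseteq> search_sequences n \<Longrightarrow> lp_optimal n t \<alpha> \<delta> D p v \<Longrightarrow>
      i \<in> {1..n} \<Longrightarrow> p i \<le> \<delta> i \<Longrightarrow> u_opt n t \<alpha> p + ereal \<gamma> \<le> ereal v"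
    using lp_gap_if_binding[OF \<delta>] by blast
  \<comment> \<open>Chosen so that the total error \<open>h * C\<close> is at most both the gap
    \<gamma> and \<open>\<epsilon> * t_min\<close>.\<close>
  define h where "h = min \<gamma> (\<epsilon> * t_min) / C"
  have "h > 0"
    unfolding h_def using \<open>\<gamma> > 0\<close> \<open>\<epsilon> > 0\<close> t_min_pos \<open>C \<ge> 1\<close> by simp
  \<comment> \<open>Boxes start at 1, so coordinate 0 is free to carry the LP value.\<close>
  define x where "x = (\<lambda>k i. if i = 0 then v k else p k i)"
  have "\<bar>x k i\<bar> \<le> C" if "k \<ge> 2" "i \<in> {0..n}" for k i
    using v_bound[OF that(1)] p(2)[of k i] p_le[of k i] \<open>C \<ge> 1\<close> that by (auto simp: x_def)
  then obtain k k' where kk': "2 \<le> k" "k < k'" and close: "\<And>i. i \<in> {0..n} \<Longrightarrow> \<bar>x k i - x k' i\<bar> < h"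
    using ex_close_pair[of "{0..n}" h 2 x C] \<open>h > 0\<close> by auto
  have k1: "1 \<le> k"
    using kk' by simp
  define L where "L = (\<Sum>i=1..n. p k i * y k i)"
  have L: "u_opt n t \<alpha> (p k) = ereal L"
    using u_opt_eq_gittins[where p = "p k", OF p(2)[OF k1] sum_p[OF k1] \<xi>[OF k1]]
      u_mixed_real[OF y(1)[OF k1], of "p k"]
    by (simp add: L_def)
  have L_ge: "t_min \<le> L"
    using u_opt_ge_t_min[of "p k"] p(2)[OF k1] sum_p[OF k1] by (simp add: L less_imp_le)
  have "v k < v k' + h"
    using close[of 0] by (simp add: x_def)
  also have "v k' \<le> (\<Sum>i=1..n. p k' i * y k i)"
    using v_le[OF k1 kk'(2)] .
  also have "\<dots> \<le> (\<Sum>i=1..n. p k i * y k i + h * (?M / \<delta> i))"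
  proof (rule sum_mono)
    fix i assume i: "i \<in> {1..n}"
    have "p k' i \<le> p k i + h"
      using close[of i] i by (auto simp: x_def)
    then have "p k' i * y k i \<le> (p k i + h) * y k i"
      using y(2)[OF k1 i] by (rule mult_right_mono)
    also have "\<dots> \<le> p k i * y k i + h * (?M / \<delta> i)"
      using mult_left_mono[OF y(3)[OF k1 i], of h] \<open>h > 0\<close> by (simp add: distrib_right)
    finally show "p k' i * y k i \<le> p k i * y k i + h * (?M / \<delta> i)" .
  qed
  also have "\<dots> + h = L + h * C"
    by (simp add: L_def C_def sum.distrib sum_distrib_left algebra_simps)
  also have "h * C = min \<gamma> (\<epsilon> * t_min)"
    using \<open>C \<ge> 1\<close> by (simp add: h_def)
  \<comment> \<open>The first bound excludes a binding constraint; the second gives the ratio test,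
    because \<open>t_min \<le> L\<close>.\<close>
  finally have v: "v k < L + \<gamma>" "v k < L + \<epsilon> * t_min"
    by auto
  have "L > 0"
    using L_ge t_min_pos by simp
  have "p k i > \<delta> i" if "i \<in> {1..n}" for i
    using \<gamma>[OF D[OF k1] opt[OF k1] that] v(1) by (auto simp: L not_less[symmetric])
  moreover have "v k / L - 1 < \<epsilon>"
  proof -
    have "\<epsilon> * t_min \<le> \<epsilon> * L"
      using L_ge \<open>\<epsilon> > 0\<close> by simp
    then show ?thesis
      using v(2) \<open>L > 0\<close> by (simp add: field_simps)
  qed
  then have "ereal (v k) / u_opt n t \<alpha> (p k) - 1 < ereal \<epsilon>"
    using \<open>L > 0\<close> by (simp add: L one_ereal_def)
  ultimately show False
    using nostop[OF k1] by (simp add: stops_def)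
qed

end

theorem theorem11:
  fixes n :: nat and t \<alpha> \<delta> :: "nat \<Rightarrow> real" and \<epsilon> :: real
    and D :: "nat \<Rightarrow> (nat \<Rightarrow> nat) set" and p :: "nat \<Rightarrow> nat \<Rightarrow> real"
    and v :: "nat \<Rightarrow> real" and \<xi> :: "nat \<Rightarrow> nat \<Rightarrow> nat"
  assumes "n \<ge> 1"
    and "\<And>i. i \<in> {1..n} \<Longrightarrow> t i > 0"
    and "\<And>i. i \<in> {1..n} \<Longrightarrow> 0 < \<alpha> i \<and> \<alpha> i < 1"
    and "\<And>i. i \<in> {1..n} \<Longrightarrow> 0 < \<delta> i \<and> \<delta> i < eta n t \<alpha> i"
    and "\<epsilon> > 0"
    and "algorithm_run n t \<alpha> \<delta> \<epsilon> D p v \<xi>"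
  shows "\<exists>k\<ge>1. ereal (v k) / u_opt n t \<alpha> (p k) - 1 < ereal \<epsilon> \<and> (\<forall>i\<in>{1..n}. p k i > \<delta> i)"
proof -
  interpret search_game n t \<alpha>
    using assms(1-3) by unfold_locales
  show ?thesis
    using algorithm_terminates[OF assms(4-6)] by (simp add: stops_def)
qed

end
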